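(* Let $\mathbb{H}=\left(\frac{a,b}{\mathbb{F}}\right)$ be a quaternion algebra over a field $\mathbb{F}$. If $\mathbf{A}\in \mathrm{M}(n,\mathbb{H})$ is an invertible matrix, then for arbitrary $p,q=1,\dots,n$ the quasideterminant $|\mathbf{A}|_{pq}$ has the following representations: $$|\mathbf{A}|_{pq}=\operatorname{ddet}\mathbf{A}\,(\mathbb{L}_{pq})^{-1}=\operatorname{ddet}\mathbf{A}\,\bigl(\operatorname{cdet}_q\,(\mathbf{A}^*\mathbf{A})_{.q}(\mathbf{A}^*_{.p})\bigr)^{-1}=\frac{\operatorname{ddet}\mathbf{A}}{\mathrm{n}\bigl(\operatorname{cdet}_q\,(\mathbf{A}^*\mathbf{A})_{.q}(\mathbf{A}^*_{.p})\bigr)}\;\overline{\operatorname{cdet}_q\,(\mathbf{A}^*\mathbf{A})_{.q}(\mathbf{A}^*_{.p})},$$ $$|\mathbf{A}|_{pq}=\operatorname{ddet}\mathbf{A}\,(\mathbb{R}_{pq})^{-1}=\operatorname{ddet}\mathbf{A}\,\bigl(\operatorname{rdet}_p\,(\mathbf{A}\mathbf{A}^* )_{p.}(\mathbf{A}^*_{q.})\bigr)^{-1}=\frac{\operatorname{ddet}\mathbf{A}}{\mathrm{n}\bigl(\operatorname{rdet}_p\,(\mathbf{A}\mathbf{A}^* )_{p.}(\mathbf{A}^*_{q.})\bigr)}\;\overline{\operatorname{rdet}_p\,(\mathbf{A}\mathbf{A}^* )_{p.}(\mathbf{A}^*_{q.})}.$$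
   Context: **Quaternion algebra.** $\mathbb{F}$ is a field, $a,b\in\mathbb{F}$, and $\mathbb{H}=\left(\frac{a,b}{\mathbb{F}}\right)$ is the four-dimensional associative $\mathbb{F}$-algebra with basis $1,i,j,k$ and $i^2=a$, $j^2=b$, $ij=k$, $ji=-k$. For $x=x^0+x^1i+x^2j+x^3k$ the trace is $\mathrm{t}(x)=2x^0$, the conjugate is $\overline{x}=\mathrm{t}(x)-x$, and the norm is the multiplicative quadratic form $\mathrm{n}(x)=x\overline{x}=\overline{x}x\in\mathbb{F}$. $\mathrm{M}(n,\mathbb{H})$ is the ring of $n\times n$ matrices over $\mathbb{H}$ with the usual row-by-column product. **Matrix notation.** For $\mathbf{A}=(a_{ij})$, $\mathbf{A}^*=(\overline{a_{ji}})$ is the Hermitian adjoint (conjugate transpose). $\mathbf{A}^*_{.p}$ is the $p$-th column of $\mathbf{A}^*$ and $\mathbf{A}^*_{q.}$ is the $q$-th row of $\mathbf{A}^*$. For a matrix $\mathbf{B}$, $\mathbf{B}_{.q}(\mathbf{b})$ denotes $\mathbf{B}$ with its $q$-th column replaced by the column $\mathbf{b}$, and $\mathbf{B}_{p.}(\mathbf{b})$ denotes $\mathbf{B}$ with its $p$-th row replaced by the row $\mathbf{b}$. **Row determinant.** Let $S_n$ be the symmetric group on $\{1,\dots,n\}$. For $\mathbf{B}=(b_{ij})\in\mathrm{M}(n,\mathbb{H})$ and $i\in\{1,\dots,n\}$, $$\operatorname{rdet}_i\mathbf{B}=\sum_{\sigma\in S_n}(-1)^{n-r}\,b_{i\,i_{k_1}}b_{i_{k_1}i_{k_1+1}}\cdots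 b_{i_{k_1+l_1}\,i}\;\cdots\; b_{i_{k_r}i_{k_r+1}}\cdots b_{i_{k_r+l_r}\,i_{k_r}},$$ where each $\sigma$ is written as a product of its $r$ disjoint cycles (fixed points counted as cycles of length one) $$\sigma=(i\,i_{k_1}i_{k_1+1}\dots i_{k_1+l_1})(i_{k_2}i_{k_2+1}\dots i_{k_2+l_2})\cdots(i_{k_r}i_{k_r+1}\dots i_{k_r+l_r}),$$ with the first cycle from the left starting with $i$, and the other cycles satisfying $i_{k_2}<i_{k_3}<\dots<i_{k_r}$ and $i_{k_t}<i_{k_t+s}$ for all $t=2,\dots,r$, $s=1,\dots,l_t$ (each other cycle starts with its least element, and these least elements increase from left to right). If $i$ is a fixed point, the first cycle is $(i)$ and contributes the factor $b_{ii}$; likewise another fixed point $m$ contributes $b_{mm}$. **Column determinant.** For $j\in\{1,\dots,n\}$, $$\operatorname{cdet}_j\mathbf{B}=\sum_{\tau\in S_n}(-1)^{n-r}\,b_{j_{k_r}j_{k_r+l_r}}\cdots b_{j_{k_r+1}j_{k_r}}\;\cdots\; b_{j\,j_{k_1+l_1}}\cdots b_{j_{k_1+1}j_{k_1}}b_{j_{k_1}j},$$ where each $\tau$ is written as a product of its $r$ disjoint cycles $$\tau=(j_{k_r+l_r}\dots j_{k_r+1}j_{k_r})\cdots(j_{k_2+l_2}\dots j_{k_2+1}j_{k_2})(j_{k_1+l_1}\dots j_{k_1+1}j_{k_1}j),$$ with the first cycle from the right ending (on the right) with $j$, and $j_{k_2}<j_{k_3}<\dots<j_{k_r}$, $j_{k_t}<j_{k_t+s}$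 for all $t=2,\dots,r$, $s=1,\dots,l_t$. Fixed points contribute diagonal factors as before. (For instance, for $n=2$: $\operatorname{rdet}_1\mathbf{B}=b_{11}b_{22}-b_{12}b_{21}$ and $\operatorname{cdet}_1\mathbf{B}=b_{22}b_{11}-b_{12}b_{21}$.) **Double determinant.** If $\mathbf{B}$ is Hermitian ($\mathbf{B}^*=\mathbf{B}$), then all $\operatorname{rdet}_i\mathbf{B}$ and $\operatorname{cdet}_i\mathbf{B}$, $i=1,\dots,n$, coincide and lie in $\mathbb{F}$ (known fact); the common value is $\det\mathbf{B}$. The double determinant of $\mathbf{A}\in\mathrm{M}(n,\mathbb{H})$ is $\operatorname{ddet}\mathbf{A}=\det(\mathbf{A}^*\mathbf{A})=\det(\mathbf{A}\mathbf{A}^* )\in\mathbb{F}$ (the two are known to be equal). **Double cofactors.** The left and right double $pq$-th cofactors $\mathbb{L}_{pq}$, $\mathbb{R}_{pq}$ of the entry $a_{pq}$ of $\mathbf{A}$ are the coefficients in the expansions $\operatorname{ddet}\mathbf{A}=\operatorname{cdet}_q(\mathbf{A}^*\mathbf{A})=\sum_p\mathbb{L}_{pq}a_{pq}$ and $\operatorname{ddet}\mathbf{A}=\operatorname{rdet}_p(\mathbf{A}\mathbf{A}^* )=\sum_q a_{pq}\mathbb{R}_{pq}$; explicitly, $$\mathbb{L}_{pq}=\operatorname{cdet}_q\,(\mathbf{A}^*\mathbf{A})_{.q}(\mathbf{A}^*_{.p}),\qquad \mathbb{R}_{pq}=\operatorname{rdet}_p\,(\mathbf{A}\mathbf{A}^*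 )_{p.}(\mathbf{A}^*_{q.}).$$ **Quasideterminant.** For an invertible matrix $\mathbf{A}\in\mathrm{M}(n,\mathbb{H})$, the $(p,q)$-quasideterminant of $\mathbf{A}$ is the formal expression $|\mathbf{A}|_{pq}=\bigl((\mathbf{A}^{-1})_{qp}\bigr)^{-1}$. *)

theory Defs
  imports
    "HOL-Combinatorics.Orbits"
    "Jordan_Normal_Form.Determinant"
begin

section \<open>Quaternion algebras\<close>

text \<open>
  The algebra is the whole type \<open>'h\<close>, viewed as an \<open>'f\<close>-algebra through \<open>scale\<close>; scalars \<open>c\<close> of the
  field are identified with the elements \<open>scale c 1\<close>. There is no restriction on the characteristic,
  and \<open>a\<close>, \<open>b\<close> are arbitrary, so \<open>'h\<close> need not be a division ring.
\<close>

locale quaternion_algebra = vector_space scale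
  for scale :: "'f::field \<Rightarrow> 'h::ring_1 \<Rightarrow> 'h" +
  fixes a b :: 'f and i j :: 'h
  assumes scale_mult_left: "scale c x * y = scale c (x * y)"
    and scale_mult_right: "x * scale c y = scale c (x * y)"
    and i_square: "i * i = scale a 1"
    and j_square: "j * j = scale b 1"
    and j_i: "j * i = - (i * j)"
    and basis_distinct: "distinct [1, i, j, i * j]"
    and basis_independent: "independent {1, i, j, i * j}"
    and basis_span: "span {1, i, j, i * j} = UNIV"

definition qtrace :: "('f::field \<Rightarrow> 'h::ring_1 \<Rightarrow> 'h) \<Rightarrow> 'h \<Rightarrow> 'h \<Rightarrow> 'h \<Rightarrow> 'f" where
  "qtrace scale i j x = 2 * module.representation scale {1, i, j, i * j} x 1"

definition qconj :: "('f::field \<Rightarrow> 'h::ring_1 \<Rightarrow> 'h) \<Rightarrow> 'h \<Rightarrow> 'h \<Rightarrow> 'h \<Rightarrow> 'h" where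
  "qconj scale i j x = scale (qtrace scale i j x) 1 - x"

text \<open>The norm as an element of the field.\<close>

definition qnorm :: "('f::field \<Rightarrow> 'h::ring_1 \<Rightarrow> 'h) \<Rightarrow> 'h \<Rightarrow> 'h \<Rightarrow> 'h \<Rightarrow> 'f" where
  "qnorm scale i j x = (THE c. scale c 1 = x * qconj scale i j x)"


section \<open>Inverses in a noncommutative ring and of matrices over it\<close>

definition invertible_elem :: "'h::ring_1 \<Rightarrow> bool" where
  "invertible_elem x \<longleftrightarrow> (\<exists>y. x * y = 1 \<and> y * x = 1)"

text \<open>
  As with \<open>inverse 0 = 0\<close> in fields, elements without an inverse are mapped to 0. Since 0 is never
  the inverse of an element, \<open>ring_inv x = 0\<close> exactly if \<open>x\<close> has no inverse.
\<close>

definition ring_inv :: "'h::ring_1 \<Rightarrow> 'h" where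
  "ring_inv x = (if invertible_elem x then THE y. x * y = 1 \<and> y * x = 1 else 0)"

definition mat_inv :: "'h::ring_1 mat \<Rightarrow> 'h mat" where
  "mat_inv A = (THE B. inverts_mat A B \<and> inverts_mat B A)"

definition adjoint :: "('f::field \<Rightarrow> 'h::ring_1 \<Rightarrow> 'h) \<Rightarrow> 'h \<Rightarrow> 'h \<Rightarrow> 'h mat \<Rightarrow> 'h mat" where
  "adjoint scale i j A = map_mat (qconj scale i j) (transpose_mat A)"

definition replace_row :: "'h mat \<Rightarrow> 'h vec \<Rightarrow> nat \<Rightarrow> 'h mat" where
  "replace_row A v k = mat (dim_row A) (dim_col A) (\<lambda>(r, c). if r = k then v $ c else A $$ (r, c))"


section \<open>Row and column determinants\<close>

text \<open>
  Indices range over \<open>0, \<dots>, n - 1\<close>. \<open>cycle_prod B \<sigma> m\<close> is the product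
  \<open>b\<^bsub>m,\<sigma>(m)\<^esub> b\<^bsub>\<sigma>(m),\<sigma>(\<sigma>(m))\<^esub> \<dots> b\<^bsub>\<dots>,m\<^esub>\<close> along the cycle of \<open>\<sigma>\<close> through \<open>m\<close>.
\<close>

definition cycle_prod :: "'h::ring_1 mat \<Rightarrow> (nat \<Rightarrow> nat) \<Rightarrow> nat \<Rightarrow> 'h" where
  "cycle_prod B \<sigma> m =
     prod_list (map (\<lambda>t. B $$ ((\<sigma> ^^ t) m, (\<sigma> ^^ Suc t) m)) [0..<card (orbit \<sigma> m)])"

text \<open>
  One distinguished index per cycle of a permutation \<open>\<sigma>\<close> of \<open>{0..<n}\<close> (fixed points included): first
  \<open>k\<close>, for its own cycle, and then the least elements of the other cycles in increasing order. In
  particular the length of this list is the number of cycles.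
\<close>

definition cycle_starts :: "nat \<Rightarrow> nat \<Rightarrow> (nat \<Rightarrow> nat) \<Rightarrow> nat list" where
  "cycle_starts n k \<sigma> =
     k # sorted_list_of_set {m \<in> {0..<n}. k \<notin> orbit \<sigma> m \<and> m = Min (orbit \<sigma> m)}"

definition rdet :: "nat \<Rightarrow> 'h::ring_1 mat \<Rightarrow> 'h" where
  "rdet k B = (\<Sum>\<sigma> | \<sigma> permutes {0..<dim_row B}.
     (- 1) ^ (dim_row B - length (cycle_starts (dim_row B) k \<sigma>)) *
     prod_list (map (cycle_prod B \<sigma>) (cycle_starts (dim_row B) k \<sigma>)))"

text \<open>
  In the column determinant the factors belonging to a cycle, read from left to right, also begin
  and end at its distinguished index (e.g. the rightmost block is
  \<open>b\<^bsub>j,x\<^esub> \<dots> b\<^bsub>z,y\<^esub> b\<^bsub>y,j\<^esub>\<close>), so that each cycle contributes a \<open>cycle_prod\<close> as before; but the cycles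
  are listed from right to left.
\<close>

definition cdet :: "nat \<Rightarrow> 'h::ring_1 mat \<Rightarrow> 'h" where
  "cdet k B = (\<Sum>\<sigma> | \<sigma> permutes {0..<dim_row B}.
     (- 1) ^ (dim_row B - length (cycle_starts (dim_row B) k \<sigma>)) *
     prod_list (map (cycle_prod B \<sigma>) (rev (cycle_starts (dim_row B) k \<sigma>))))"

text \<open>
  The determinant of a Hermitian matrix: the common value, in the field, of all its row and column
  determinants.
\<close>

definition hermitian_det :: "('f::field \<Rightarrow> 'h::ring_1 \<Rightarrow> 'h) \<Rightarrow> 'h mat \<Rightarrow> 'f" where
  "hermitian_det scale B =
     (THE d. \<forall>k < dim_row B. rdet k B = scale d 1 \<and> cdet k B = scale d 1)"

definition ddet :: "('f::field \<Rightarrow> 'h::ring_1 \<Rightarrow> 'h) \<Rightarrow> 'h \<Rightarrow> 'h \<Rightarrow> 'h mat \<Rightarrow> 'f" where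
  "ddet scale i j A = hermitian_det scale (adjoint scale i j A * A)"

definition left_double_cofactor ::
  "('f::field \<Rightarrow> 'h::ring_1 \<Rightarrow> 'h) \<Rightarrow> 'h \<Rightarrow> 'h \<Rightarrow> 'h mat \<Rightarrow> nat \<Rightarrow> nat \<Rightarrow> 'h" where
  "left_double_cofactor scale i j A p q =
     cdet q (replace_col (adjoint scale i j A * A) (col (adjoint scale i j A) p) q)"

definition right_double_cofactor ::
  "('f::field \<Rightarrow> 'h::ring_1 \<Rightarrow> 'h) \<Rightarrow> 'h \<Rightarrow> 'h \<Rightarrow> 'h mat \<Rightarrow> nat \<Rightarrow> nat \<Rightarrow> 'h" where
  "right_double_cofactor scale i j A p q =
     rdet p (replace_row (A * adjoint scale i j A) (row (adjoint scale i j A) q) p)"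


section \<open>Quasideterminants\<close>

definition quasidet_defined :: "'h::ring_1 mat \<Rightarrow> nat \<Rightarrow> nat \<Rightarrow> bool" where
  "quasidet_defined A p q \<longleftrightarrow> invertible_elem (mat_inv A $$ (q, p))"

definition quasidet :: "'h::ring_1 mat \<Rightarrow> nat \<Rightarrow> nat \<Rightarrow> 'h" where
  "quasidet A p q = ring_inv (mat_inv A $$ (q, p))"

end

theory Submission
  imports Defs "HOL-Combinatorics.Cycles"
begin

text \<open>
  Grouping permutations by the cycle through the distinguished index turns a row determinant into a
  signed sum over simple closed paths, weighted by the determinant of the remaining indices. For a
  Hermitian form, reversing paths pairs the terms into traces and norms. This gives, in every
  characteristic, that the determinant is central and independent of the distinguished index, and
  that replacing a row by another one yields 0; hence \<open>(A A\<^sup>*) C = det (A A\<^sup>*)\<close> for the matrix \<open>C\<close> of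
  cofactors, so that the double cofactor is \<open>det (A A\<^sup>*)\<close> times the entry of the inverse. The same
  vanishing makes the determinant invariant under Hermitian transvections. Applied to block matrices,
  this yields the invertibility of \<open>det (A A\<^sup>*)\<close> and \<open>det (A\<^sup>* A) = det (A A\<^sup>*)\<close>. Column determinants are
  conjugates of row determinants.
\<close>

section \<open>Determinants as sums over paths\<close>

text \<open>Opening one cycle of a permutation leaves a path, and a path together with cycles on the
  remaining indices serves as a minor whose row set and column set differ; hence sums over lists
  rather than over permutations. Since entries do not commute, such a sum can be expanded only along
  the row that supplies the leftmost factor. Statements about columns are therefore conjugates of
  statements about rows, and in place of a multiplication theorem there are congruences that change
  one row and the matching column at a time, combined with Schur complements. In characteristic 2
  the conjugation is the identity map, so neither halving a trace nor being fixed by conjugation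
  places an element in the field. Every reversal argument must therefore treat its fixed points
  separately, and the diagonal entries of a form are required to lie in the field.\<close>

definition paths :: "'i set \<Rightarrow> 'i list set" where
  "paths S = {xs. distinct xs \<and> set xs \<subseteq> S}"

lemma mem_paths: "xs \<in> paths S \<longleftrightarrow> distinct xs \<and> set xs \<subseteq> S"
  by (simp add: paths_def)

lemma finite_paths [simp]: "finite S \<Longrightarrow> finite (paths S)"
  unfolding paths_def using finite_subset_distinct[of S] by (simp add: conj_commute)

lemma rev_paths: "xs \<in> paths S \<Longrightarrow> rev xs \<in> paths S"
  by (simp add: paths_def)

lemma paths_Cons_decomp:
  "paths S = insert [] ((\<lambda>(y, ys). y # ys) ` (SIGMA y:S. paths (S - {y})))"
proof (rule Set.set_eqI)
  fix xs show "xs \<in> paths S \<longleftrightarrow> xs \<in> insert [] ((\<lambda>(y, ys). y # ys) ` (SIGMA y:S. paths (S - {y})))"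
    by (cases xs) (auto simp: paths_def image_iff)
qed

lemma sum_paths_Cons:
  assumes "finite S"
  shows "(\<Sum>xs\<in>paths S. f xs) = f [] + (\<Sum>y\<in>S. \<Sum>ys\<in>paths (S - {y}). f (y # ys))"
proof -
  have "(\<Sum>xs\<in>paths S. f xs) = f [] + (\<Sum>xs\<in>(\<lambda>(y, ys). y # ys) ` (SIGMA y:S. paths (S - {y})). f xs)"
    unfolding paths_Cons_decomp[of S] using assms
    by (subst sum.insert) (auto intro!: finite_imageI finite_SigmaI)
  also have "(\<Sum>xs\<in>(\<lambda>(y, ys). y # ys) ` (SIGMA y:S. paths (S - {y})). f xs)
    = (\<Sum>y\<in>S. \<Sum>ys\<in>paths (S - {y}). f (y # ys))"
    using assms
    by (subst sum.reindex) (auto simp: inj_on_def sum.Sigma intro!: sum.cong)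
  finally show ?thesis .
qed

text \<open>A path through \<open>l\<close> is cut at its unique occurrence of \<open>l\<close> into
  two disjoint pieces; the other paths stay in \<open>T\<close>.\<close>

lemma sum_paths_split:
  assumes "finite T" "l \<notin> T"
  shows "(\<Sum>xs\<in>paths (insert l T). f xs) = (\<Sum>xs\<in>paths T. f xs)
     + (\<Sum>p\<in>paths T. \<Sum>q\<in>paths (T - set p). f (p @ l # q))"
proof -
  let ?g = "\<lambda>(p, q). p @ l # q"
  let ?P = "SIGMA p:paths T. paths (T - set p)"
  have "paths (insert l T) = paths T \<union> ?g ` ?P"
  proof (rule Set.set_eqI, rule iffI)
    fix xs assume xs: "xs \<in> paths (insert l T)"
    show "xs \<in> paths T \<union> ?g ` ?P"
    proof (cases "l \<in> set xs")
      case True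
      then obtain p q where pq: "xs = p @ l # q"
        by (auto dest: split_list)
      with xs assms have "(p, q) \<in> ?P"
        by (auto simp: paths_def)
      then show ?thesis unfolding pq by force
    qed (use xs in \<open>auto simp: paths_def\<close>)
  qed (use assms in \<open>auto simp: paths_def\<close>)
  moreover have "paths T \<inter> ?g ` ?P = {}"
    using assms by (auto simp: paths_def)
  moreover have "inj_on ?g ?P"
  proof (rule inj_onI, clarsimp simp: paths_def)
    fix p q p' q'
    assume "set p \<subseteq> T" "set q \<subseteq> T - set p" "set p' \<subseteq> T" "set q' \<subseteq> T - set p'"
      and eq: "p @ l # q = p' @ l # q'"
    then have "l \<notin> set p" "l \<notin> set p'" "l \<notin> set q" "l \<notin> set q'"
      using assms by auto
    then show "p = p' \<and> q = q'"
      using eq by (simp add: append_Cons_eq_iff)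
  qed
  ultimately show ?thesis
    using assms by (simp add: sum.union_disjoint sum.reindex finite_SigmaI sum.Sigma case_prod_unfold)
qed

text \<open>Both sides run over the ordered pairs of disjoint paths.\<close>

lemma sum_paths_swap:
  assumes "finite T"
  shows "(\<Sum>p\<in>paths T. \<Sum>q\<in>paths (T - set p). f p q) = (\<Sum>q\<in>paths T. \<Sum>p\<in>paths (T - set q). f p q)"
  using assms
  by (simp add: sum.Sigma)
    (rule sum.reindex_bij_witness[of _ "\<lambda>(q, p). (p, q)" "\<lambda>(p, q). (q, p)"]; auto simp: paths_def)

lemma sum_paths_rev: "(\<Sum>xs\<in>paths S. f (rev xs)) = (\<Sum>xs\<in>paths S. f xs)"
  by (rule sum.reindex_bij_witness[of _ rev rev]) (auto simp: rev_paths)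

text \<open>The first and last entries of a palindrome agree, so distinctness leaves at most one
  entry. Closed up at \<open>k\<close>, the paths fixed by reversal are thus the cycles of length
  one and two.\<close>

lemma palindromic_path:
  assumes "rev xs = xs" "distinct xs"
  shows "xs = [] \<or> (\<exists>y. xs = [y])"
proof (cases xs)
  case (Cons y ys)
  have "last xs = hd xs"
    by (metis assms(1) hd_rev)
  then have "ys = []"
    using assms(2) last_in_set[of ys] by (auto simp: Cons split: if_splits)
  then show ?thesis using Cons by simp
qed simp

text \<open>Pairing under \<open>g\<close> without dividing by 2: two-element orbits contribute
  \<open>f x + f (g x)\<close>, fixed points contribute alone. \<open>P\<close> will be membership
  in the centre-like set \<open>Z\<close>, or being 0.\<close>

lemma involution_sum_induct:
  fixes f :: "'a \<Rightarrow> 'b::ab_group_add"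
  assumes "finite X" "\<And>x. x \<in> X \<Longrightarrow> g x \<in> X" "\<And>x. x \<in> X \<Longrightarrow> g (g x) = x"
    and zero: "P 0" and add: "\<And>x y. P x \<Longrightarrow> P y \<Longrightarrow> P (x + y)"
    and fixpoint: "\<And>x. x \<in> X \<Longrightarrow> g x = x \<Longrightarrow> P (f x)"
    and pair: "\<And>x. x \<in> X \<Longrightarrow> P (f x + f (g x))"
  shows "P (sum f X)"
  using assms(1-3) fixpoint pair
proof (induction "card X" arbitrary: X rule: less_induct)
  case less
  show ?case
  proof (cases "X = {}")
    case False
    then obtain x where x: "x \<in> X" by blast
    let ?Y = "X - {x, g x}"
    have gY: "g y \<in> ?Y" if "y \<in> ?Y" for y
      using that x less.prems(2,3) by (metis DiffD1 DiffD2 DiffI insert_iff empty_iff)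
    have "P (sum f ?Y)"
      using less.prems x gY
      by (intro less.hyps) (auto intro!: psubset_card_mono)
    moreover have "P (sum f {x, g x})"
      using less.prems(4,5) x by (cases "g x = x") auto
    moreover have "sum f X = sum f {x, g x} + sum f ?Y"
      using less.prems(1,2) x by (subst sum.subset_diff[of "{x, g x}"]) (auto simp: add.commute)
    ultimately show ?thesis using add by simp
  qed (simp add: zero)
qed

section \<open>Signed walks and recursive determinants\<close>

text \<open>Each inner vertex contributes a minus sign, so a closed walk carries the sign of its
  cycle, and (-1)^(n-r) is distributed over the cycles.\<close>

fun walk :: "('i \<Rightarrow> 'i \<Rightarrow> 'h::ring_1) \<Rightarrow> 'i \<Rightarrow> 'i list \<Rightarrow> 'i \<Rightarrow> 'h" where
  "walk b x [] k = b x k"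
| "walk b x (y # ys) k = - (b x y * walk b y ys k)"

lemma walk_append: "walk b x (p @ l # q) k = - (walk b x p l * walk b l q k)"
  by (induction p arbitrary: x) (auto simp: mult.assoc)

lemma walk_cong:
  assumes "\<And>u v. u \<in> insert x (set xs) \<Longrightarrow> v \<in> insert k (set xs) \<Longrightarrow> b u v = b' u v"
  shows "walk b x xs k = walk b' x xs k"
  using assms
proof (induction xs arbitrary: x)
  case (Cons y ys)
  have "walk b y ys k = walk b' y ys k"
    by (rule Cons.IH) (auto intro: Cons.prems)
  then show ?case using Cons.prems by simp
qed simp

text \<open>Cycles start at their least elements and are listed in increasing order, as they are
  behind the first cycle of a row determinant. The value 1 belongs to the empty index set and is a
  mere default on infinite sets.\<close>

function hdet :: "('i::linorder \<Rightarrow> 'i \<Rightarrow> 'h::ring_1) \<Rightarrow> 'i set \<Rightarrow> 'h" where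
  "hdet b S = (if finite S \<and> S \<noteq> {} then
     \<Sum>xs\<in>paths (S - {Min S}). walk b (Min S) xs (Min S) * hdet b (S - {Min S} - set xs) else 1)"
  by auto
termination
  by (relation "measure (\<lambda>(b, S). card S)") (auto intro!: psubset_card_mono dest: Min_in)

declare hdet.simps [simp del]

text \<open>
  For \<open>x, k \<notin> S\<close>, this plays, up to sign, the role of the minor with rows \<open>S \<union> {x}\<close> and columns \<open>S \<union> {k}\<close>.
\<close>

definition bdet :: "('i::linorder \<Rightarrow> 'i \<Rightarrow> 'h::ring_1) \<Rightarrow> 'i set \<Rightarrow> 'i \<Rightarrow> 'i \<Rightarrow> 'h" where
  "bdet b S x k = (\<Sum>xs\<in>paths S. walk b x xs k * hdet b (S - set xs))"

lemma hdet_empty [simp]: "hdet b {} = 1"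
  by (simp add: hdet.simps)

lemma hdet_Min: "finite S \<Longrightarrow> S \<noteq> {} \<Longrightarrow> hdet b S = bdet b (S - {Min S}) (Min S) (Min S)"
  by (subst hdet.simps) (simp add: bdet_def)

text \<open>The first step of a path from \<open>x\<close> either ends at \<open>k\<close> or enters
  some \<open>y\<close>. This is the expansion along row \<open>x\<close>, with the entries of that
  row as left factors.\<close>

lemma bdet_rec:
  assumes "finite S"
  shows "bdet b S x k = b x k * hdet b S - (\<Sum>y\<in>S. b x y * bdet b (S - {y}) y k)"
proof -
  have "S - insert y (set ys) = S - {y} - set ys" for y ys by blast
  then show ?thesis
    unfolding bdet_def
    by (subst sum_paths_Cons[OF assms]) (simp add: sum_distrib_left mult.assoc sum_negf)
qed

lemma hdet_cong:
  assumes "\<And>u v. u \<in> S \<Longrightarrow> v \<in> S \<Longrightarrow> b u v = b' u v"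
  shows "hdet b S = hdet b' S"
  using assms
proof (induction b S rule: hdet.induct)
  case (1 b S)
  show ?case
  proof (cases "finite S \<and> S \<noteq> {}")
    case True
    then have m [simp]: "Min S \<in> S" by simp
    have "walk b (Min S) xs (Min S) = walk b' (Min S) xs (Min S) \<and>
      hdet b (S - {Min S} - set xs) = hdet b' (S - {Min S} - set xs)"
      if "xs \<in> paths (S - {Min S})" for xs
      using True m that by (auto intro!: "1.IH" "1.prems" walk_cong m simp: paths_def subset_iff simp del: Min_in)
    then show ?thesis using True
      by (simp add: hdet.simps[of b S] hdet.simps[of b' S])
  qed (auto simp: hdet.simps)
qed

lemma bdet_cong:
  assumes "\<And>u v. u \<in> insert x S \<Longrightarrow> v \<in> insert k S \<Longrightarrow> b u v = b' u v"
  shows "bdet b S x k = bdet b' S x k"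
  unfolding bdet_def
  using assms by (intro sum.cong refl arg_cong2[of _ _ _ _ "(*)"] walk_cong hdet_cong) (auto simp: paths_def)

section \<open>Hermitian forms over a ring with central norms and traces\<close>

text \<open>\<open>Z\<close> stands for the copy of the field inside the quaternion algebra. It may
  be smaller than the set of fixed elements of \<open>conj\<close>, so membership of traces and
  norms is stated explicitly.\<close>

locale central_involution =
  fixes conj :: "'h::ring_1 \<Rightarrow> 'h" and Z :: "'h set"
  assumes conj_add: "conj (x + y) = conj x + conj y"
    and conj_mult: "conj (x * y) = conj y * conj x"
    and conj_conj [simp]: "conj (conj x) = x"
    and Z_one [simp]: "1 \<in> Z"
    and Z_diff: "x \<in> Z \<Longrightarrow> y \<in> Z \<Longrightarrow> x - y \<in> Z"
    and Z_mult: "x \<in> Z \<Longrightarrow> y \<in> Z \<Longrightarrow> x * y \<in> Z"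
    and Z_central: "z \<in> Z \<Longrightarrow> z * x = x * z"
    and conj_Z: "z \<in> Z \<Longrightarrow> conj z = z"
    and trace_Z: "x + conj x \<in> Z"
    and norm_Z: "x * conj x \<in> Z"
begin

lemma Z_zero [simp]: "0 \<in> Z"
  using Z_diff[OF Z_one Z_one] by simp

lemma Z_uminus: "x \<in> Z \<Longrightarrow> - x \<in> Z"
  using Z_diff[OF Z_zero] by simp

lemma Z_add: "x \<in> Z \<Longrightarrow> y \<in> Z \<Longrightarrow> x + y \<in> Z"
  using Z_diff[OF _ Z_uminus] by fastforce

lemma Z_sum: "(\<And>x. x \<in> A \<Longrightarrow> f x \<in> Z) \<Longrightarrow> sum f A \<in> Z"
  by (induction A rule: infinite_finite_induct) (auto simp: Z_add)

lemma conj_zero [simp]: "conj 0 = 0" and conj_one [simp]: "conj 1 = 1"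
  by (simp_all add: conj_Z)

lemma conj_uminus: "conj (- x) = - conj x"
  using conj_add[of x "- x"] by (simp add: eq_neg_iff_add_eq_0 add.commute)

lemma conj_diff: "conj (x - y) = conj x - conj y"
  using conj_add[of x "- y"] by (simp add: conj_uminus)

lemma conj_sum: "conj (sum f A) = (\<Sum>x\<in>A. conj (f x))"
  by (induction A rule: infinite_finite_induct) (auto simp: conj_add)

lemma conj_prod_list: "conj (prod_list xs) = prod_list (rev (map conj xs))"
  by (induction xs) (simp_all add: conj_mult)

lemma norm_comm: "conj x * x = x * conj x"
proof -
  have "(x + conj x) * x = x * (x + conj x)"
    by (rule Z_central[OF trace_Z])
  then show ?thesis by (simp add: algebra_simps)
qed

lemma norm_Z': "conj x * x \<in> Z"
  by (simp add: norm_comm norm_Z)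

text \<open>Writing each conjugate as a central trace minus the element gives
  \<open>conj y * conj x - conj x * conj y = y * x - x * y\<close>.\<close>

lemma trace_mult_comm: "x * y + conj (x * y) = y * x + conj (y * x)"
proof -
  define r s where "r = x + conj x" and "s = y + conj y"
  have c: "conj x = r - x" "conj y = s - y"
    by (simp_all add: r_def s_def)
  have "s * r = r * s" "y * r = r * y" "x * s = s * x"
    using Z_central[OF trace_Z] by (metis r_def s_def)+
  then have "conj y * conj x - conj x * conj y = y * x - x * y"
    by (simp add: c algebra_simps)
  then show ?thesis by (simp add: conj_mult algebra_simps)
qed

text \<open>The condition on the diagonal is what makes fixed points central; for Gram matrices the
  diagonal consists of sums of norms.\<close>

definition hermitian_form :: "('i \<Rightarrow> 'i \<Rightarrow> 'h) \<Rightarrow> bool" where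
  "hermitian_form b \<longleftrightarrow> (\<forall>x y. b y x = conj (b x y)) \<and> (\<forall>x. b x x \<in> Z)"

lemma hermitian_formI:
  "(\<And>x y. b y x = conj (b x y)) \<Longrightarrow> (\<And>x. b x x \<in> Z) \<Longrightarrow> hermitian_form b"
  unfolding hermitian_form_def by blast

lemma hermitian_form_conj: "hermitian_form b \<Longrightarrow> conj (b x y) = b y x"
  unfolding hermitian_form_def by metis

lemma hermitian_form_diag: "hermitian_form b \<Longrightarrow> b x x \<in> Z"
  unfolding hermitian_form_def by blast

section \<open>Path reversal in Hermitian forms\<close>

lemma conj_walk:
  assumes "hermitian_form b"
  shows "conj (walk b x xs k) = walk b k (rev xs) x"
  by (induction xs arbitrary: x)
    (simp_all add: hermitian_form_conj[OF assms] conj_uminus conj_mult walk_append)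

text \<open>A closed walk and its reversal add up to a trace. The self-reverse walks are
  \<open>b k k\<close> and \<open>- (b k y * b y k)\<close>, a diagonal entry and the negative of a
  norm.\<close>

lemma closed_paths_in_Z:
  assumes b: "hermitian_form b" and "finite T" and D: "\<And>R. R \<subseteq> T \<Longrightarrow> hdet b R \<in> Z"
  shows "bdet b T k k \<in> Z"
  unfolding bdet_def
proof (rule involution_sum_induct[where g = rev and P = "\<lambda>x. x \<in> Z"])
  fix xs assume xs: "xs \<in> paths T"
  have "walk b k xs k * hdet b (T - set xs) + walk b k (rev xs) k * hdet b (T - set (rev xs))
     = (walk b k xs k + conj (walk b k xs k)) * hdet b (T - set xs)"
    by (simp add: conj_walk[OF b] distrib_right)
  then show "walk b k xs k * hdet b (T - set xs) + walk b k (rev xs) k * hdet b (T - set (rev xs)) \<in> Z"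
    by (simp add: Z_mult trace_Z D)
next
  fix xs assume "xs \<in> paths T" "rev xs = xs"
  then consider "xs = []" | y where "xs = [y]"
    using palindromic_path by (auto simp: paths_def)
  then have "walk b k xs k \<in> Z"
  proof cases
    case 2
    then show ?thesis
      using norm_Z[of "b k y"] by (simp add: hermitian_form_conj[OF b] Z_uminus)
  qed (simp add: hermitian_form_diag[OF b])
  then show "walk b k xs k * hdet b (T - set xs) \<in> Z"
    by (simp add: Z_mult D)
qed (use \<open>finite T\<close> in \<open>auto simp: Z_add rev_paths\<close>)

text \<open>Reversing and exchanging the two paths conjugates the commutator of their walks, and a
  commutator has trace 0. A fixed pair has \<open>p = rev q\<close> with \<open>p\<close>,
  \<open>q\<close> disjoint, so both are empty and \<open>b k l\<close> commutes with its
  conjugate.\<close>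

lemma two_paths_commute:
  assumes b: "hermitian_form b" and "finite T" and D: "\<And>R. R \<subseteq> T \<Longrightarrow> hdet b R \<in> Z"
  shows "(\<Sum>p\<in>paths T. \<Sum>q\<in>paths (T - set p). walk b k p l * walk b l q k * hdet b (T - set p - set q))
    = (\<Sum>p\<in>paths T. \<Sum>q\<in>paths (T - set p). walk b l q k * walk b k p l * hdet b (T - set p - set q))"
proof -
  let ?c = "\<lambda>p q. walk b k p l * walk b l q k - walk b l q k * walk b k p l"
  let ?f = "\<lambda>(p, q). ?c p q * hdet b (T - set p - set q)"
  have "sum ?f (SIGMA p:paths T. paths (T - set p)) = 0"
  proof (rule involution_sum_induct[where g = "\<lambda>(p, q). (rev q, rev p)" and P = "\<lambda>x. x = 0"])
    fix pq assume "pq \<in> (SIGMA p:paths T. paths (T - set p))"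
    then obtain p q where pq: "pq = (p, q)" by auto
    have "?c (rev q) (rev p) = conj (?c p q)"
      by (simp add: conj_diff conj_mult conj_walk[OF b])
    moreover have "T - set q - set p = T - set p - set q" by blast
    ultimately have "?f pq + ?f (case pq of (p, q) \<Rightarrow> (rev q, rev p))
        = (?c p q + conj (?c p q)) * hdet b (T - set p - set q)"
      by (simp add: pq distrib_right)
    also have "?c p q + conj (?c p q) = 0"
      using trace_mult_comm[of "walk b k p l" "walk b l q k"] by (simp add: conj_diff algebra_simps)
    finally show "?f pq + ?f (case pq of (p, q) \<Rightarrow> (rev q, rev p)) = 0" by simp
  next
    fix pq assume "pq \<in> (SIGMA p:paths T. paths (T - set p))"
      and "(case pq of (p, q) \<Rightarrow> (rev q, rev p)) = pq"
    then obtain p q where pq: "pq = (p, q)" "p = rev q" "set q \<subseteq> T - set q"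
      by (auto simp: paths_def)
    from pq(3) have "q = []" by (cases q) auto
    with pq(2) have "p = []" "q = []" by simp_all
    then show "?f pq = 0"
      using norm_comm[of "b k l"] by (simp add: pq(1) hermitian_form_conj[OF b])
  qed (use \<open>finite T\<close> in \<open>auto simp: mem_paths\<close>)
  then show ?thesis
    using \<open>finite T\<close> by (simp add: sum.Sigma[symmetric] left_diff_distrib sum_subtractf)
qed

lemma bdet_split:
  assumes "finite T" "l \<notin> T"
  shows "bdet b (insert l T) x k = (\<Sum>p\<in>paths T. walk b x p k * hdet b (insert l (T - set p)))
    - (\<Sum>p\<in>paths T. \<Sum>q\<in>paths (T - set p). walk b x p l * walk b l q k * hdet b (T - set p - set q))"
proof -
  have "insert l T - set p = insert l (T - set p)" if "p \<in> paths T" for p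
    using that assms by (auto simp: paths_def)
  moreover have "insert l T - insert l (set p \<union> set q) = T - set p - set q" for p q
    using assms by auto
  ultimately show ?thesis
    unfolding bdet_def using assms by (subst sum_paths_split) (simp_all add: walk_append sum_negf)
qed

text \<open>For fixed \<open>p\<close>, the closed walks at \<open>l\<close> through the indices
  left over by \<open>p\<close>, with their remainders, make up the expansion of one determinant at
  \<open>l\<close>.\<close>

lemma closed_paths_sum:
  assumes "finite T" and l: "l \<notin> T"
    and D: "\<And>R. R \<subseteq> T \<Longrightarrow> hdet b (insert l R) = bdet b R l l"
  shows "(\<Sum>p\<in>paths T. \<Sum>q\<in>paths (T - set p). f p * walk b l q l * hdet b (T - set p - set q))
    = (\<Sum>p\<in>paths T. f p * hdet b (insert l (T - set p)))"
  by (auto simp: D bdet_def sum_distrib_left mult.assoc intro!: sum.cong)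

text \<open>
  A cycle through \<open>k\<close> avoids \<open>l\<close> or passes through it. The former contribute the same to both sides
  because the cycles through \<open>l\<close> and \<open>k\<close> are then disjoint and sum up to central elements; the latter
  because a trace of a product does not depend on the order of the two factors.
\<close>

lemma bdet_diagonal_eq:
  assumes b: "hermitian_form b" and T: "finite T" "k \<notin> T" "l \<notin> T" "k \<noteq> l"
    and Z: "\<And>R. R \<subseteq> T \<Longrightarrow> hdet b R \<in> Z"
    and Dk: "\<And>R. R \<subseteq> T \<Longrightarrow> hdet b (insert k R) = bdet b R k k"
    and Dl: "\<And>R. R \<subseteq> T \<Longrightarrow> hdet b (insert l R) = bdet b R l l"
  shows "bdet b (insert l T) k k = bdet b (insert k T) l l"
proof -
  let ?D = "\<lambda>p q. hdet b (T - set p - set q)"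
  have D_comm: "?D q p = ?D p q" for p q
    by (rule arg_cong[of _ _ "hdet b"]) blast
  have mid: "x * ?D p q = ?D p q * x" for x p q
    by (intro Z_central[symmetric] Z) blast
  have "(\<Sum>p\<in>paths T. walk b k p k * hdet b (insert l (T - set p)))
    = (\<Sum>p\<in>paths T. \<Sum>q\<in>paths (T - set p). walk b k p k * walk b l q l * ?D p q)"
    by (rule closed_paths_sum[symmetric]) (use T Dl in auto)
  also have "\<dots> = (\<Sum>q\<in>paths T. \<Sum>p\<in>paths (T - set q). walk b k p k * walk b l q l * ?D p q)"
    by (rule sum_paths_swap[OF T(1)])
  also have "\<dots> = (\<Sum>q\<in>paths T. (\<Sum>p\<in>paths (T - set q). walk b k p k * ?D q p) * walk b l q l)"
    by (simp add: sum_distrib_right mult.assoc D_comm mid)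
  also have "\<dots> = (\<Sum>q\<in>paths T. hdet b (insert k (T - set q)) * walk b l q l)"
    by (intro sum.cong refl) (simp add: Dk bdet_def)
  also have "\<dots> = (\<Sum>q\<in>paths T. walk b l q l * hdet b (insert k (T - set q)))"
    by (intro sum.cong refl Z_central)
      (auto simp: Dk intro!: closed_paths_in_Z[OF b] T Z)
  finally have avoid: "(\<Sum>p\<in>paths T. walk b k p k * hdet b (insert l (T - set p)))
    = (\<Sum>q\<in>paths T. walk b l q l * hdet b (insert k (T - set q)))" .
  have "(\<Sum>p\<in>paths T. \<Sum>q\<in>paths (T - set p). walk b k p l * walk b l q k * ?D p q)
    = (\<Sum>p\<in>paths T. \<Sum>q\<in>paths (T - set p). walk b l q k * walk b k p l * ?D p q)"
    by (rule two_paths_commute[OF b T(1) Z])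
  also have "\<dots> = (\<Sum>q\<in>paths T. \<Sum>p\<in>paths (T - set q). walk b l q k * walk b k p l * ?D p q)"
    by (rule sum_paths_swap[OF T(1)])
  finally have through: "(\<Sum>p\<in>paths T. \<Sum>q\<in>paths (T - set p). walk b k p l * walk b l q k * ?D p q)
    = (\<Sum>q\<in>paths T. \<Sum>p\<in>paths (T - set q). walk b l q k * walk b k p l * ?D q p)"
    by (simp add: D_comm)
  show ?thesis
    using T by (simp add: bdet_split avoid through)
qed

text \<open>The two claims need each other: centrality of smaller determinants lets factors move,
  and their expansion at any index recombines the closed walks. By definition the expansion is known
  only at \<open>Min S\<close>.\<close>

lemma hdet_central_and_expansion:
  assumes b: "hermitian_form b" and "finite S"
  shows "hdet b S \<in> Z \<and> (\<forall>k\<in>S. hdet b S = bdet b (S - {k}) k k)"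
  using \<open>finite S\<close>
proof (induction S rule: finite_psubset_induct)
  case (psubset S)
  show ?case
  proof (cases "S = {}")
    case False
    define m where "m = Min S"
    have m: "m \<in> S" and Dm: "hdet b S = bdet b (S - {m}) m m"
      using False psubset.hyps by (auto simp: m_def hdet_Min)
    have Z: "hdet b R \<in> Z" if "R \<subset> S" for R
      using psubset.IH that by blast
    have ins: "hdet b (insert k R) = bdet b R k k" if "insert k R \<subset> S" "k \<notin> R" for k R
      using psubset.IH[OF that(1)] that(2) by simp
    have "hdet b S \<in> Z"
      unfolding Dm using psubset.hyps m by (intro closed_paths_in_Z b Z) auto
    moreover have "hdet b S = bdet b (S - {k}) k k" if k: "k \<in> S" for k
    proof (cases "k = m")
      case False
      let ?T = "S - {k, m}"
      have eq: "S - {k} = insert m ?T" "S - {m} = insert k ?T"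
        using k m False by auto
      have "bdet b (insert k ?T) m m = bdet b (insert m ?T) k k"
        using psubset.hyps k m False
        by (intro bdet_diagonal_eq b Z ins) auto
      then show ?thesis by (simp only: Dm eq)
    qed (simp add: Dm)
    ultimately show ?thesis by blast
  qed simp
qed

lemma hdet_Z: "hermitian_form b \<Longrightarrow> finite S \<Longrightarrow> hdet b S \<in> Z"
  by (simp add: hdet_central_and_expansion)

lemma hdet_insert: "hermitian_form b \<Longrightarrow> finite S \<Longrightarrow> k \<notin> S \<Longrightarrow> hdet b (insert k S) = bdet b S k k"
  using hdet_central_and_expansion[of b "insert k S"] by simp

lemma hdet_comm: "hermitian_form b \<Longrightarrow> finite S \<Longrightarrow> hdet b S * x = x * hdet b S"
  by (simp add: Z_central hdet_Z)

text \<open>Conjugation reverses the paths and fixes the central determinants beside them. This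
  turns row statements into column statements.\<close>

lemma conj_bdet:
  assumes "hermitian_form b" "finite S"
  shows "conj (bdet b S x k) = bdet b S k x"
proof -
  have "conj (bdet b S x k) = (\<Sum>xs\<in>paths S. walk b k (rev xs) x * hdet b (S - set (rev xs)))"
    using assms by (simp add: bdet_def conj_sum conj_mult conj_walk conj_Z hdet_Z hdet_comm)
  then show ?thesis
    by (simp only: bdet_def sum_paths_rev[of "\<lambda>xs. walk b k xs x * hdet b (S - set xs)"])
qed

text \<open>The analogue of the vanishing of a determinant with two equal rows.\<close>

lemma bdet_row_eq_0:
  assumes b: "hermitian_form b" and "finite S" "z \<in> S"
  shows "bdet b S z k = 0"
proof -
  obtain T where T: "S = insert z T" "z \<notin> T" "finite T"
    using assms by (metis finite_insert mk_disjoint_insert)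
  have D: "hdet b (insert z R) = bdet b R z z" if "R \<subseteq> T" for R
    using T that by (intro hdet_insert b) (auto intro: finite_subset)
  let ?D = "\<lambda>p q. hdet b (T - set p - set q)"
  \<comment> \<open>These are the paths that return to \<open>z\<close>. Summing over the closed
    part \<open>p\<close> completes a determinant containing \<open>z\<close>, and the result
    cancels the paths that avoid \<open>z\<close>.\<close>
  have "(\<Sum>p\<in>paths T. \<Sum>q\<in>paths (T - set p). walk b z p z * walk b z q k * ?D p q)
    = (\<Sum>q\<in>paths T. \<Sum>p\<in>paths (T - set q). walk b z p z * walk b z q k * ?D p q)"
    by (rule sum_paths_swap[OF T(3)])
  also have "\<dots> = (\<Sum>q\<in>paths T. (\<Sum>p\<in>paths (T - set q). walk b z p z * ?D q p) * walk b z q k)"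
  proof -
    have "?D p q = ?D q p" for p q
      by (rule arg_cong[of _ _ "hdet b"]) blast
    then show ?thesis
      by (simp add: sum_distrib_right mult.assoc hdet_comm b T)
  qed
  also have "\<dots> = (\<Sum>q\<in>paths T. hdet b (insert z (T - set q)) * walk b z q k)"
    by (intro sum.cong refl) (simp add: D bdet_def)
  also have "\<dots> = (\<Sum>q\<in>paths T. walk b z q k * hdet b (insert z (T - set q)))"
    using T by (simp add: hdet_comm b)
  finally show ?thesis using T by (simp add: bdet_split)
qed

lemma bdet_col_eq_0:
  assumes b: "hermitian_form b" and "finite S" "z \<in> S"
  shows "bdet b S x z = 0"
  using conj_bdet[OF assms(1,2), of z x] bdet_row_eq_0[OF assms] by simp

end

section \<open>Transvections and Schur complements\<close>

context central_involution
begin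

text \<open>Left linearity in the row that supplies the leftmost factors; the other rows are not
  altered.\<close>

lemma bdet_row_combination:
  assumes "finite R" and r: "\<And>v. v \<in> insert k R \<Longrightarrow> r v = b x v + (\<Sum>z\<in>S. c z * b z v)"
  shows "r k * hdet b R - (\<Sum>v\<in>R. r v * bdet b (R - {v}) v k)
    = bdet b R x k + (\<Sum>z\<in>S. c z * bdet b R z k)"
proof -
  have "(\<Sum>v\<in>R. r v * bdet b (R - {v}) v k)
    = (\<Sum>v\<in>R. b x v * bdet b (R - {v}) v k) + (\<Sum>v\<in>R. \<Sum>z\<in>S. c z * (b z v * bdet b (R - {v}) v k))"
    by (simp add: r distrib_right sum.distrib sum_distrib_right mult.assoc)
  also have "(\<Sum>v\<in>R. \<Sum>z\<in>S. c z * (b z v * bdet b (R - {v}) v k))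
    = (\<Sum>z\<in>S. c z * (\<Sum>v\<in>R. b z v * bdet b (R - {v}) v k))"
    by (subst sum.swap) (simp add: sum_distrib_left)
  finally show ?thesis
    by (simp add: r bdet_rec[OF \<open>finite R\<close>] distrib_right right_diff_distrib sum_subtractf
        sum_distrib_right mult.assoc)
qed

text \<open>Left multiples of the rows in \<open>S\<close> are added to row \<open>x\<close>, then
  conjugate right multiples of the columns to column \<open>x\<close>. After both expansions, every
  extra term is a minor with a repeated row or column.\<close>

lemma hdet_transvection:
  assumes b: "hermitian_form b" and b': "hermitian_form b'" and S: "finite S" "x \<notin> S"
    and off: "\<And>u v. u \<in> S \<Longrightarrow> v \<in> S \<Longrightarrow> b' u v = b u v"
    and r: "\<And>v. v \<in> insert x S \<Longrightarrow> r v = b x v + (\<Sum>z\<in>S. c z * b z v)"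
    and row: "\<And>v. v \<in> S \<Longrightarrow> b' x v = r v"
    and diag: "b' x x = r x + (\<Sum>z\<in>S. r z * conj (c z))"
  shows "hdet b' (insert x S) = hdet b (insert x S)"
proof -
  have D: "hdet b' R = hdet b R" if "R \<subseteq> S" for R
    using that off by (intro hdet_cong) blast
  \<comment> \<open>Column \<open>x\<close> supplies the last factor of a walk, out of reach of a
    row expansion; so the formula is proved for row \<open>x\<close> and conjugated.\<close>
  have col: "bdet b' R y x = bdet b R y x + (\<Sum>z\<in>S. bdet b R y z * conj (c z))"
    if "R \<subseteq> S" "y \<in> S" for R y
  proof -
    have fin: "finite R" using that S finite_subset by blast
    have "bdet b' R x y = b' x y * hdet b' R - (\<Sum>v\<in>R. b' x v * bdet b' (R - {v}) v y)"
      by (rule bdet_rec[OF fin])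
    also have "\<dots> = r y * hdet b R - (\<Sum>v\<in>R. r v * bdet b (R - {v}) v y)"
    proof -
      have "bdet b' (R - {v}) v y = bdet b (R - {v}) v y" if "v \<in> R" for v
        using that \<open>R \<subseteq> S\<close> \<open>y \<in> S\<close> by (intro bdet_cong off) auto
      moreover have "b' x v = r v" if "v \<in> R" for v
        using that \<open>R \<subseteq> S\<close> by (intro row) auto
      ultimately show ?thesis
        by (simp add: D[OF \<open>R \<subseteq> S\<close>] row[OF \<open>y \<in> S\<close>])
    qed
    also have "\<dots> = bdet b R x y + (\<Sum>z\<in>S. c z * bdet b R z y)"
      using that by (intro bdet_row_combination[OF fin] r) auto
    finally have "conj (bdet b' R x y) = conj (bdet b R x y + (\<Sum>z\<in>S. c z * bdet b R z y))"
      by simp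
    then show ?thesis
      using fin by (simp add: conj_bdet b b' conj_add conj_sum conj_mult)
  qed
  have comb: "r k * hdet b S - (\<Sum>v\<in>S. r v * bdet b (S - {v}) v k)
      = bdet b S x k + (\<Sum>z\<in>S. c z * bdet b S z k)" if "k \<in> insert x S" for k
    using that by (intro bdet_row_combination[OF S(1)] r) auto
  have "bdet b' S x x = b' x x * hdet b S - (\<Sum>y\<in>S. r y * bdet b' (S - {y}) y x)"
    using bdet_rec[OF S(1), of b' x x] by (simp add: D row)
  also have "(\<Sum>y\<in>S. r y * bdet b' (S - {y}) y x) = (\<Sum>y\<in>S. r y * bdet b (S - {y}) y x)
      + (\<Sum>y\<in>S. \<Sum>z\<in>S. r y * bdet b (S - {y}) y z * conj (c z))"
    by (simp add: col subset_iff distrib_left sum.distrib sum_distrib_left mult.assoc)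
  also have "(\<Sum>y\<in>S. \<Sum>z\<in>S. r y * bdet b (S - {y}) y z * conj (c z))
      = (\<Sum>z\<in>S. (\<Sum>y\<in>S. r y * bdet b (S - {y}) y z) * conj (c z))"
    by (subst sum.swap) (simp add: sum_distrib_right)
  also have "b' x x * hdet b S = r x * hdet b S + (\<Sum>z\<in>S. r z * hdet b S * conj (c z))"
    by (simp add: diag distrib_right sum_distrib_right mult.assoc hdet_comm[OF b S(1)])
  finally have "bdet b' S x x = (r x * hdet b S - (\<Sum>y\<in>S. r y * bdet b (S - {y}) y x))
      + (\<Sum>z\<in>S. (r z * hdet b S - (\<Sum>y\<in>S. r y * bdet b (S - {y}) y z)) * conj (c z))"
    by (simp add: left_diff_distrib sum_subtractf algebra_simps)
  \<comment> \<open>By \<open>comb\<close> each bracket is a minor of the combined row. For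
    \<open>z\<close> in \<open>S\<close>, both \<open>bdet b S z k\<close> and
    \<open>bdet b S x z\<close> vanish, which leaves one term.\<close>
  also have "\<dots> = bdet b S x x"
    using S by (simp add: comb bdet_row_eq_0[OF b] bdet_col_eq_0[OF b])
  finally show ?thesis
    using S b b' by (simp add: hdet_insert)
qed

section \<open>Congruences and block decompositions\<close>

text \<open>Exchanging \<open>z\<close> and \<open>z'\<close> pairs the off-diagonal terms into
  traces; a diagonal term is \<open>b z z\<close> times a norm. This keeps the diagonal of a
  congruent form in \<open>Z\<close>.\<close>

lemma quadratic_form_Z:
  assumes b: "hermitian_form b" and "finite P"
  shows "(\<Sum>z\<in>P. \<Sum>z'\<in>P. c z * b z z' * conj (c z')) \<in> Z"
proof -
  have "(\<Sum>(z, z')\<in>P \<times> P. c z * b z z' * conj (c z')) \<in> Z"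
  proof (rule involution_sum_induct[where g = "\<lambda>(z, z'). (z', z)" and P = "\<lambda>x. x \<in> Z"])
    fix zz assume "zz \<in> P \<times> P"
    obtain z z' where zz: "zz = (z, z')" by (cases zz)
    have "c z' * b z' z * conj (c z) = conj (c z * b z z' * conj (c z'))"
      by (simp add: conj_mult hermitian_form_conj[OF b] mult.assoc)
    then show "(case zz of (z, z') \<Rightarrow> c z * b z z' * conj (c z'))
      + (case (case zz of (z, z') \<Rightarrow> (z', z)) of (z, z') \<Rightarrow> c z * b z z' * conj (c z')) \<in> Z"
      by (simp add: zz trace_Z)
  next
    fix zz assume "zz \<in> P \<times> P" "(case zz of (z, z') \<Rightarrow> (z', z)) = zz"
    then obtain z where zz: "zz = (z, z)" by auto
    have "c z * b z z * conj (c z) = b z z * (c z * conj (c z))"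
      using Z_central[OF hermitian_form_diag[OF b, of z], of "c z"] by (metis mult.assoc)
    then show "(case zz of (z, z') \<Rightarrow> c z * b z z' * conj (c z')) \<in> Z"
      using Z_mult[OF hermitian_form_diag[OF b, of z] norm_Z[of "c z"]] by (simp add: zz)
  qed (use assms in \<open>auto simp: Z_add\<close>)
  then show ?thesis
    using assms by (simp add: sum.cartesian_product)
qed

text \<open>The congruence of \<open>b\<close> by \<open>1 + E\<close>, that is \<open>1 + E\<close>
  times \<open>b\<close> times the adjoint of \<open>1 + E\<close>, where \<open>E\<close> has the
  entries \<open>e u z\<close> with \<open>z\<close> in \<open>P\<close>.\<close>

definition block_transvect :: "'i set \<Rightarrow> ('i \<Rightarrow> 'i \<Rightarrow> 'h) \<Rightarrow> ('i \<Rightarrow> 'i \<Rightarrow> 'h) \<Rightarrow> 'i \<Rightarrow> 'i \<Rightarrow> 'h" where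
  "block_transvect P e b u v = b u v + (\<Sum>z\<in>P. e u z * b z v) + (\<Sum>z\<in>P. b u z * conj (e v z))
     + (\<Sum>z\<in>P. \<Sum>z'\<in>P. e u z * b z z' * conj (e v z'))"

lemma hermitian_block_transvect:
  assumes b: "hermitian_form b" and P: "finite P"
  shows "hermitian_form (block_transvect P e b)"
proof (rule hermitian_formI)
  show "block_transvect P e b y x = conj (block_transvect P e b x y)" for x y
  proof -
    have "conj (block_transvect P e b x y) = b y x + (\<Sum>z\<in>P. b y z * conj (e x z)) + (\<Sum>z\<in>P. e y z * b z x)
      + (\<Sum>z\<in>P. \<Sum>z'\<in>P. e y z' * b z' z * conj (e x z))"
      by (simp add: block_transvect_def conj_add conj_sum conj_mult hermitian_form_conj[OF b] mult.assoc)
    then show ?thesis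
      by (simp add: block_transvect_def sum.swap[of "\<lambda>z z'. e y z' * b z' z * conj (e x z)"])
  qed
  show "block_transvect P e b x x \<in> Z" for x
  proof -
    have "(\<Sum>z\<in>P. b x z * conj (e x z)) = conj (\<Sum>z\<in>P. e x z * b z x)"
      by (simp add: conj_sum conj_mult hermitian_form_conj[OF b])
    then have "block_transvect P e b x x = b x x + ((\<Sum>z\<in>P. e x z * b z x) + conj (\<Sum>z\<in>P. e x z * b z x))
        + (\<Sum>z\<in>P. \<Sum>z'\<in>P. e x z * b z z' * conj (e x z'))"
      by (simp add: block_transvect_def add.assoc)
    then show ?thesis
      by (simp add: Z_add hermitian_form_diag[OF b] trace_Z quadratic_form_Z[OF b P])
  qed
qed

text \<open>Rows of \<open>Q\<close> are changed one at a time by transvections. Multiples pass only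
  from \<open>P\<close> to the disjoint set \<open>Q\<close>, so the successive steps compose to the
  whole congruence.\<close>

lemma hdet_block_transvect:
  assumes b: "hermitian_form b" and P: "finite P" and "finite Q" and PQ: "P \<inter> Q = {}"
    and e: "\<And>u z. u \<notin> Q \<Longrightarrow> e u z = 0"
  shows "hdet (block_transvect P e b) (P \<union> Q) = hdet b (P \<union> Q)"
proof -
  let ?t = "\<lambda>e. block_transvect P e b"
  note t_def = block_transvect_def and herm = hermitian_block_transvect[OF b P]
  have "hdet (?t (\<lambda>u. if u \<in> U then e u else (\<lambda>_. 0))) (P \<union> Q) = hdet b (P \<union> Q)"
    if "U \<subseteq> Q" for U
    using finite_subset[OF that \<open>finite Q\<close>] that
  proof (induction U rule: finite_induct)
    case empty
    show ?case by (simp add: t_def)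
  next
    case (insert x U)
    let ?e = "\<lambda>u. if u \<in> U then e u else (\<lambda>_. 0)"
    let ?e' = "\<lambda>u. if u \<in> insert x U then e u else (\<lambda>_. 0)"
    let ?S = "P \<union> Q - {x}"
    \<comment> \<open>The coefficients are extended by 0, since a transvection draws on all
      remaining indices.\<close>
    let ?c = "\<lambda>z. if z \<in> P then e x z else 0"
    let ?r = "\<lambda>v. ?t ?e x v + (\<Sum>z\<in>P. e x z * ?t ?e z v)"
    have x: "x \<in> Q" "x \<notin> P" "insert x ?S = P \<union> Q" and S: "P \<inter> ?S = P" "?S \<inter> P = P"
      using insert.prems PQ by auto
    have [simp]: "z \<in> P \<Longrightarrow> z \<notin> U" "z \<in> P \<Longrightarrow> z \<noteq> x" for z
      using insert.prems PQ by auto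
    have "hdet (?t ?e') (insert x ?S) = hdet (?t ?e) (insert x ?S)"
    proof (rule hdet_transvection[OF herm herm, where r = ?r and c = ?c])
      show "finite ?S" using P \<open>finite Q\<close> by simp
      show "?r v = ?t ?e x v + (\<Sum>z\<in>?S. ?c z * ?t ?e z v)" for v
        using P \<open>finite Q\<close> by (simp add: if_distrib[of "\<lambda>c. c * _"] sum.inter_restrict[symmetric] S cong: if_cong)
      show "?t ?e' u v = ?t ?e u v" if "u \<in> ?S" "v \<in> ?S" for u v
        using that by (simp add: t_def)
      show "?t ?e' x v = ?r v" if "v \<in> ?S" for v
        using that insert.hyps
        by (simp add: t_def distrib_left sum.distrib sum_distrib_left mult.assoc algebra_simps)
      show "?t ?e' x x = ?r x + (\<Sum>z\<in>?S. ?r z * conj (?c z))"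
      proof -
        have "(\<Sum>z\<in>?S. ?r z * conj (?c z)) = (\<Sum>z\<in>P. ?r z * conj (e x z))"
          using P \<open>finite Q\<close>
          by (simp add: if_distrib[of conj] if_distrib[of "\<lambda>c. _ * c"] sum.inter_restrict[symmetric] S cong: if_cong)
        also have "\<dots> = (\<Sum>z\<in>P. b x z * conj (e x z)) + (\<Sum>z\<in>P. \<Sum>z'\<in>P. e x z' * b z' z * conj (e x z))"
          using insert.hyps
          by (simp add: t_def distrib_right sum.distrib sum_distrib_right)
        also have "(\<Sum>z\<in>P. \<Sum>z'\<in>P. e x z' * b z' z * conj (e x z))
            = (\<Sum>z\<in>P. \<Sum>z'\<in>P. e x z * b z z' * conj (e x z'))"
          by (rule sum.swap)
        finally show ?thesis
          using insert.hyps by (simp add: t_def)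
      qed
    qed simp
    then show ?case
      using insert.IH insert.prems unfolding x(3) by simp
  qed
  from this[of Q] have "hdet (?t (\<lambda>u. if u \<in> Q then e u else (\<lambda>_. 0))) (P \<union> Q) = hdet b (P \<union> Q)"
    by simp
  moreover have "(\<lambda>u. if u \<in> Q then e u else (\<lambda>_. 0)) = e"
    using e by (intro ext) simp
  ultimately show ?thesis by simp
qed

text \<open>A path that starts in \<open>P\<close> never enters \<open>Q\<close> with a nonzero
  weight. Determinants and open minors are handled in one induction because each expansion refers to
  both.\<close>

lemma hdet_block_diagonal:
  assumes b: "hermitian_form b" and "finite P" and Q: "finite Q" and PQ: "P \<inter> Q = {}"
    and zero: "\<And>p q. p \<in> P \<Longrightarrow> q \<in> Q \<Longrightarrow> b p q = 0"
  shows "hdet b (P \<union> Q) = hdet b P * hdet b Q"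
proof -
  have "R \<subseteq> P \<longrightarrow> hdet b (R \<union> Q) = hdet b R * hdet b Q \<and>
    (\<forall>x\<in>P. \<forall>k\<in>P. bdet b (R \<union> Q) x k = bdet b R x k * hdet b Q)" if "finite R" for R
    using that
  proof (induction R rule: finite_psubset_induct)
    case (psubset R)
    show ?case
    proof (intro impI)
      assume RP: "R \<subseteq> P"
      then have RQ: "R \<union> Q - {y} = (R - {y}) \<union> Q" if "y \<in> R" for y
        using that PQ by auto
      have IH: "hdet b (R - {y} \<union> Q) = hdet b (R - {y}) * hdet b Q"
        "x \<in> P \<Longrightarrow> k \<in> P \<Longrightarrow> bdet b (R - {y} \<union> Q) x k = bdet b (R - {y}) x k * hdet b Q"
        if "y \<in> R" for y x k
        using psubset.IH[of "R - {y}"] that RP by auto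
      have D: "hdet b (R \<union> Q) = hdet b R * hdet b Q"
      proof (cases "R = {}")
        case False
        then obtain y where y: "y \<in> R" by blast
        then have "hdet b (R \<union> Q) = bdet b (R \<union> Q - {y}) y y" "hdet b R = bdet b (R - {y}) y y"
          using hdet_central_and_expansion[OF b, of "R \<union> Q"] hdet_central_and_expansion[OF b, of R]
            psubset.hyps Q by auto
        then show ?thesis
          using y RP by (simp add: RQ IH subset_iff)
      qed simp
      moreover have "bdet b (R \<union> Q) x k = bdet b R x k * hdet b Q" if "x \<in> P" "k \<in> P" for x k
      proof -
        have "(\<Sum>y\<in>R \<union> Q. b x y * bdet b (R \<union> Q - {y}) y k) = (\<Sum>y\<in>R. b x y * bdet b (R \<union> Q - {y}) y k)"
          using psubset.hyps Q that zero by (intro sum.mono_neutral_right) auto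
        also have "\<dots> = (\<Sum>y\<in>R. b x y * bdet b (R - {y}) y k) * hdet b Q"
          unfolding sum_distrib_right using RP that
          by (intro sum.cong refl) (auto simp: RQ IH mult.assoc)
        finally show ?thesis
          using psubset.hyps Q by (simp add: bdet_rec[of "R \<union> Q"] bdet_rec[of R] D left_diff_distrib mult.assoc)
      qed
      ultimately show "hdet b (R \<union> Q) = hdet b R * hdet b Q \<and>
        (\<forall>x\<in>P. \<forall>k\<in>P. bdet b (R \<union> Q) x k = bdet b R x k * hdet b Q)" by blast
    qed
  qed
  then show ?thesis using \<open>finite P\<close> by blast
qed

text \<open>\<open>X\<close> plays the role of minus the \<open>Q\<close>-\<open>P\<close> block
  times the inverse of the \<open>P\<close> block. The congruence it defines clears this block and,
  by Hermitian symmetry, the opposite one.\<close>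

lemma hdet_schur_complement:
  assumes b: "hermitian_form b" and P: "finite P" and Q: "finite Q" and PQ: "P \<inter> Q = {}"
    and elim: "\<And>q p. q \<in> Q \<Longrightarrow> p \<in> P \<Longrightarrow> (\<Sum>z\<in>P. X q z * b z p) = - b q p"
    and s: "\<And>q q'. q \<in> Q \<Longrightarrow> q' \<in> Q \<Longrightarrow> s q q' = b q q' + (\<Sum>z\<in>P. X q z * b z q')"
  shows "hdet b (P \<union> Q) = hdet b P * hdet s Q"
proof -
  let ?e = "\<lambda>u z. if u \<in> Q then X u z else 0"
  let ?b' = "block_transvect P ?e b"
  have b': "hermitian_form ?b'"
    by (rule hermitian_block_transvect[OF b P])
  have [simp]: "p \<in> P \<Longrightarrow> p \<notin> Q" for p
    using PQ by blast
  have qp: "?b' q p = 0" if "q \<in> Q" "p \<in> P" for q p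
    using that by (simp add: block_transvect_def elim)
  have pp: "?b' p p' = b p p'" if "p \<in> P" "p' \<in> P" for p p'
    using that by (simp add: block_transvect_def)
  have qq: "?b' q q' = s q q'" if q: "q \<in> Q" "q' \<in> Q" for q q'
  proof -
    \<comment> \<open>By the elimination equation the quadratic term cancels the column correction,
      so only the row correction in \<open>s\<close> remains.\<close>
    have "(\<Sum>z\<in>P. \<Sum>z'\<in>P. X q z * b z z' * conj (X q' z')) = (\<Sum>z'\<in>P. (\<Sum>z\<in>P. X q z * b z z') * conj (X q' z'))"
      by (subst sum.swap) (simp add: sum_distrib_right)
    also have "\<dots> = - (\<Sum>z'\<in>P. b q z' * conj (X q' z'))"
      using q by (simp add: elim sum_negf)
    finally show ?thesis
      using q by (simp add: block_transvect_def s)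
  qed
  have "hdet b (P \<union> Q) = hdet ?b' (P \<union> Q)"
    by (rule hdet_block_transvect[OF b P Q PQ, symmetric]) simp
  also have "\<dots> = hdet ?b' P * hdet ?b' Q"
  proof (rule hdet_block_diagonal[OF b' P Q PQ])
    show "?b' p q = 0" if "p \<in> P" "q \<in> Q" for p q
      using hermitian_form_conj[OF b', of q p] qp[OF that(2,1)] by simp
  qed
  also have "hdet ?b' P = hdet b P"
    by (rule hdet_cong) (rule pp)
  also have "hdet ?b' Q = hdet s Q"
    by (rule hdet_cong) (rule qq)
  finally show ?thesis .
qed

text \<open>\<open>f\<close> may disturb the order that \<open>hdet\<close> uses to choose its
  starting index; expanding at an arbitrary index removes the dependence on that order.\<close>

lemma hdet_image:
  assumes b: "hermitian_form b" and f: "inj f" and "finite S"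
  shows "hdet b (f ` S) = hdet (\<lambda>x y. b (f x) (f y)) S"
proof -
  let ?c = "\<lambda>x y. b (f x) (f y)"
  have c: "hermitian_form ?c"
    by (rule hermitian_formI) (simp_all add: hermitian_form_conj[OF b] hermitian_form_diag[OF b])
  have "hdet b (f ` S) = hdet ?c S \<and> (\<forall>x k. bdet b (f ` S) (f x) (f k) = bdet ?c S x k)"
    using \<open>finite S\<close>
  proof (induction S rule: finite_psubset_induct)
    case (psubset S)
    have im: "f ` S - {f y} = f ` (S - {y})" for y
      using f by (auto simp: inj_def)
    have D: "hdet b (f ` S) = hdet ?c S"
    proof (cases "S = {}")
      case False
      then obtain y where y: "y \<in> S" by blast
      then have "hdet b (f ` S) = bdet b (f ` (S - {y})) (f y) (f y)" "hdet ?c S = bdet ?c (S - {y}) y y"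
        using hdet_central_and_expansion[OF b, of "f ` S"] hdet_central_and_expansion[OF c, of S]
          psubset.hyps by (auto simp: im)
      then show ?thesis
        using psubset.IH[of "S - {y}"] y by auto
    qed simp
    moreover have "bdet b (f ` S) (f x) (f k) = bdet ?c S x k" for x k
    proof -
      have "(\<Sum>y\<in>f ` S. b (f x) y * bdet b (f ` S - {y}) y (f k))
        = (\<Sum>y\<in>S. ?c x y * bdet b (f ` (S - {y})) (f y) (f k))"
        using f by (subst sum.reindex) (auto simp: im inj_on_def inj_def)
      also have "\<dots> = (\<Sum>y\<in>S. ?c x y * bdet ?c (S - {y}) y k)"
      proof (intro sum.cong refl)
        show "?c x y * bdet b (f ` (S - {y})) (f y) (f k) = ?c x y * bdet ?c (S - {y}) y k" if "y \<in> S" for y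
        proof -
          have "S - {y} \<subset> S" using that by auto
          from psubset.IH[OF this] show ?thesis by simp
        qed
      qed
      finally show ?thesis
        using psubset.hyps by (simp add: bdet_rec[of S] bdet_rec[of "f ` S"] D)
    qed
    ultimately show ?case by blast
  qed
  then show ?thesis by blast
qed

section \<open>Special index configurations and isotropic sets\<close>

lemma hdet_insert_isolated:
  assumes b: "hermitian_form b" and "finite S" "x \<notin> S" and "\<And>v. v \<in> S \<Longrightarrow> b x v = 0"
  shows "hdet b (insert x S) = b x x * hdet b S"
  using assms by (simp add: hdet_insert bdet_rec[of S])

text \<open>The only neighbour of \<open>y\<close> is \<open>x\<close>, so every nonzero term
  contains the cycle of length two on \<open>x\<close> and \<open>y\<close>.\<close>

lemma hdet_insert_leaf:
  assumes b: "hermitian_form b" and S: "finite S" "x \<notin> S" "y \<notin> S" "x \<noteq> y"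
    and "b y y = 0" and zero: "\<And>v. v \<in> S \<Longrightarrow> b y v = 0"
  shows "hdet b (insert y (insert x S)) = - (b y x * b x y * hdet b S)"
proof -
  have "bdet b R y v = 0" if "R \<subseteq> S" "v \<in> S" for R v
    using that finite_subset[OF that(1) S(1)] by (simp add: bdet_rec[of R] zero subset_iff)
  then have "bdet b (S - {v}) v y = 0" if "v \<in> S" for v
    using that S conj_bdet[OF b, of "S - {v}" y v] by auto
  then have "bdet b S x y = b x y * hdet b S"
    using S by (simp add: bdet_rec[of S])
  moreover have "hdet b (insert y (insert x S)) = bdet b (insert x S) y y"
    using S by (simp add: hdet_insert b)
  ultimately show ?thesis
    using S assms(6) by (simp add: bdet_rec[of "insert x S"] zero mult.assoc)
qed

lemma hdet_insert_diag_add: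
  assumes b: "hermitian_form b" and b': "hermitian_form b'" and S: "finite S" "x \<notin> S"
    and diag: "b' x x = b x x + s"
    and off: "\<And>u v. u \<in> insert x S \<Longrightarrow> v \<in> insert x S \<Longrightarrow> u \<noteq> x \<or> v \<noteq> x \<Longrightarrow> b' u v = b u v"
  shows "hdet b' (insert x S) = hdet b (insert x S) + s * hdet b S"
proof -
  have "hdet b' S = hdet b S"
    using S by (intro hdet_cong off) auto
  moreover have "bdet b' (S - {y}) y x = bdet b (S - {y}) y x" if "y \<in> S" for y
    using S that by (intro bdet_cong off) auto
  moreover have "b' x y = b x y" if "y \<in> S" for y
    using S that by (intro off) auto
  ultimately show ?thesis
    using S by (simp add: hdet_insert b b' bdet_rec[of S] diag distrib_right)
qed

text \<open>Pigeonhole: in a nonzero term each row in \<open>N\<close> uses a column outside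
  \<open>N\<close>. In the induction the minor has an extra column \<open>k\<close> in
  \<open>N\<close>, which is of no help to those rows; an extra row \<open>x\<close> in
  \<open>N\<close> makes it vanish already at equality.\<close>

lemma hdet_large_isotropic:
  assumes b: "hermitian_form b" and "finite S"
    and N: "\<And>u v. u \<in> N \<Longrightarrow> v \<in> N \<Longrightarrow> b u v = 0"
    and less: "card (S - N) < card (S \<inter> N)"
  shows "hdet b S = 0"
proof -
  have "(card (S - N) < card (S \<inter> N) \<longrightarrow> hdet b S = 0) \<and>
    (\<forall>x k. k \<in> N \<longrightarrow> card (S - N) < card (S \<inter> N) \<or> (x \<in> N \<and> card (S - N) \<le> card (S \<inter> N)) \<longrightarrow> bdet b S x k = 0)"
    using \<open>finite S\<close>
  proof (induction S rule: finite_psubset_induct)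
    case (psubset S)
    have inN: "card (S - {y} - N) = card (S - N)" "card ((S - {y}) \<inter> N) = card (S \<inter> N) - 1" "0 < card (S \<inter> N)"
      if "y \<in> S" "y \<in> N" for y
    proof -
      have "S - {y} - N = S - N" "(S - {y}) \<inter> N = (S \<inter> N) - {y}" using that by auto
      then show "card (S - {y} - N) = card (S - N)" "card ((S - {y}) \<inter> N) = card (S \<inter> N) - 1"
        using that psubset.hyps by simp_all
      show "0 < card (S \<inter> N)" using that psubset.hyps by (auto simp: card_gt_0_iff)
    qed
    have notN: "card (S - {y} - N) = card (S - N) - 1" "card ((S - {y}) \<inter> N) = card (S \<inter> N)" "0 < card (S - N)"
      if "y \<in> S" "y \<notin> N" for y
    proof -
      have "S - {y} - N = S - N - {y}" "(S - {y}) \<inter> N = S \<inter> N" using that by auto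
      then show "card (S - {y} - N) = card (S - N) - 1" "card ((S - {y}) \<inter> N) = card (S \<inter> N)"
        using that psubset.hyps by simp_all
      show "0 < card (S - N)" using that psubset.hyps by (auto simp: card_gt_0_iff)
    qed
    have IH: "bdet b (S - {y}) x k = 0"
      if "y \<in> S" "k \<in> N" "card (S - {y} - N) < card ((S - {y}) \<inter> N) \<or>
        (x \<in> N \<and> card (S - {y} - N) \<le> card ((S - {y}) \<inter> N))" for y x k
      using psubset.IH[of "S - {y}"] that by blast
    have D: "hdet b S = 0" if less: "card (S - N) < card (S \<inter> N)"
    proof -
      from less obtain y where y: "y \<in> S" "y \<in> N"
        by (metis Int_iff card.empty equals0I not_less0)
      then have "hdet b S = bdet b (S - {y}) y y"
        using hdet_central_and_expansion[OF b, of S] psubset.hyps by auto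
      also have "\<dots> = 0"
        using y less inN[OF y] by (intro IH) auto
      finally show ?thesis .
    qed
    moreover have "bdet b S x k = 0"
      if k: "k \<in> N" and less: "card (S - N) < card (S \<inter> N) \<or> (x \<in> N \<and> card (S - N) \<le> card (S \<inter> N))" for x k
    proof -
      have "b x y * bdet b (S - {y}) y k = 0" if y: "y \<in> S" for y
      proof (cases "y \<in> N")
        case True
        show ?thesis
        proof (cases "x \<in> N")
          case False
          then have "bdet b (S - {y}) y k = 0"
            using less inN[OF y True] True by (intro IH y k) auto
          then show ?thesis by simp
        qed (simp add: N True)
      next
        case False
        have "bdet b (S - {y}) y k = 0"
          using less notN[OF y False] by (intro IH y k) auto
        then show ?thesis by simp
      qed
      moreover have "b x k * hdet b S = 0"
        using less D N k by auto
      ultimately show ?thesis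
        using psubset.hyps by (simp add: bdet_rec[of S])
    qed
    ultimately show ?case by blast
  qed
  then show ?thesis using less by blast
qed

end

section \<open>Block matrices and Gram determinants\<close>

context central_involution
begin

definition blocks :: "nat \<Rightarrow> (nat \<Rightarrow> nat \<Rightarrow> 'h) \<Rightarrow> (nat \<Rightarrow> nat \<Rightarrow> 'h) \<Rightarrow> (nat \<Rightarrow> nat \<Rightarrow> 'h) \<Rightarrow> nat \<Rightarrow> nat \<Rightarrow> 'h" where
  "blocks n G B H u v = (if u < n then if v < n then G u v else B u (v - n)
     else if v < n then conj (B v (u - n)) else H (u - n) (v - n))"

lemma hermitian_blocks:
  assumes "hermitian_form G" "hermitian_form H"
  shows "hermitian_form (blocks n G B H)"
  by (rule hermitian_formI)
    (auto simp: blocks_def hermitian_form_conj[OF assms(1)] hermitian_form_conj[OF assms(2)]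
      hermitian_form_diag[OF assms(1)] hermitian_form_diag[OF assms(2)])

lemma hermitian_diag:
  "(\<And>x. d x \<in> Z) \<Longrightarrow> hermitian_form (\<lambda>x y. if x = y then d x else 0)"
  by (rule hermitian_formI) (auto simp: conj_Z)

lemma hermitian_zero: "hermitian_form (\<lambda>_ _. 0)"
  by (rule hermitian_formI) auto

lemma hermitian_uminus: "hermitian_form b \<Longrightarrow> hermitian_form (\<lambda>x y. - b x y)"
  by (rule hermitian_formI) (simp_all add: conj_uminus hermitian_form_conj Z_uminus hermitian_form_diag)

lemma hdet_blocks_left: "hdet (blocks n G B H) {..<n} = hdet G {..<n}"
  by (rule hdet_cong) (simp add: blocks_def)

lemma hdet_blocks_right:
  assumes "hermitian_form H"
  shows "hdet (blocks n G B H) ((\<lambda>x. x + n) ` {..<n}) = hdet H {..<n}"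
proof -
  \<comment> \<open>Replacing the corner \<open>G\<close>, about which nothing is assumed, by 0
    makes the whole form Hermitian, as \<open>hdet_image\<close> requires.\<close>
  have "hdet (blocks n G B H) ((\<lambda>x. x + n) ` {..<n}) = hdet (blocks n (\<lambda>_ _. 0) B H) ((\<lambda>x. x + n) ` {..<n})"
    by (rule hdet_cong) (auto simp: blocks_def)
  also have "\<dots> = hdet (\<lambda>x y. blocks n (\<lambda>_ _. 0) B H (x + n) (y + n)) {..<n}"
    by (intro hdet_image hermitian_blocks hermitian_zero assms) (auto simp: inj_def)
  also have "\<dots> = hdet H {..<n}"
    by (rule hdet_cong) (simp add: blocks_def)
  finally show ?thesis .
qed

lemma hermitian_gram_left: "hermitian_form (\<lambda>x y. \<Sum>z\<in>S. conj (a z x) * a z y)"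
  by (rule hermitian_formI) (auto simp: conj_sum conj_mult intro!: Z_sum norm_Z')

lemma hermitian_gram_right: "hermitian_form (\<lambda>x y. \<Sum>z\<in>S. a x z * conj (a y z))"
  by (rule hermitian_formI) (auto simp: conj_sum conj_mult intro!: Z_sum norm_Z)

lemma hdet_minus_one:
  assumes "finite S"
  shows "hdet (\<lambda>x y. if x = y then - 1 else 0 :: 'h) S = (- 1) ^ card S"
  using assms
proof (induction S rule: finite_induct)
  case (insert x S)
  have "hermitian_form (\<lambda>x y. if x = y then - 1 else 0 :: 'h)"
    by (rule hermitian_diag) (simp add: Z_uminus)
  then have "hdet (\<lambda>x y. if x = y then - 1 else 0 :: 'h) (insert x S)
    = (if x = x then - 1 else 0) * hdet (\<lambda>x y. if x = y then - 1 else 0) S"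
    by (rule hdet_insert_isolated) (use insert.hyps in auto)
  then show ?case using insert.hyps by (simp add: insert.IH)
qed simp

lemma minus_one_power_square: "(- 1 :: 'h) ^ n * (- 1) ^ n = 1"
  by (simp flip: power_add power_mult_distrib)

text \<open>Index \<open>m + n\<close> is a leaf attached to \<open>m\<close>, so each step
  contributes a factor -1 whatever \<open>G\<close> is.\<close>

lemma hdet_blocks_one:
  assumes G: "hermitian_form G" and "m \<le> n"
  shows "hdet (blocks n G (\<lambda>x y. if x = y then 1 else 0) (\<lambda>_ _. 0)) ({..<m} \<union> (\<lambda>x. x + n) ` {..<m}) = (- 1) ^ m"
    (is "hdet ?b (?S m) = _")
  using \<open>m \<le> n\<close>
proof (induction m)
  case (Suc m)
  have S: "?S (Suc m) = insert (m + n) (insert m (?S m))"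
    by (auto simp: lessThan_Suc)
  have "hdet ?b (insert (m + n) (insert m (?S m))) = - (?b (m + n) m * ?b m (m + n) * hdet ?b (?S m))"
    using Suc.prems
    by (intro hdet_insert_leaf hermitian_blocks G hermitian_zero) (auto simp: blocks_def)
  then show ?case
    using Suc by (simp add: S blocks_def)
qed simp

text \<open>The Schur complement of \<open>G\<close> in the block matrix (G 1; 1 0) is
  \<open>- H\<close>, and that block matrix has determinant (-1)^n.\<close>

lemma hdet_times_inverse:
  assumes G: "hermitian_form G"
    and H: "hermitian_form H"
    and inv: "\<And>x y. x < n \<Longrightarrow> y < n \<Longrightarrow> (\<Sum>z<n. H x z * G z y) = (if x = y then 1 else 0)"
  shows "hdet G {..<n} * hdet (\<lambda>x y. - H x y) {..<n} = (- 1) ^ n"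
proof -
  let ?b = "blocks n G (\<lambda>x y. if x = y then 1 else 0) (\<lambda>_ _. 0)"
  let ?s = "blocks n (\<lambda>_ _. 0) (\<lambda>_ _. 0) (\<lambda>x y. - H x y)"
  let ?Q = "(\<lambda>x. x + n) ` {..<n}"
  have b: "hermitian_form ?b"
    by (intro hermitian_blocks G hermitian_zero)
  have "hdet ?b ({..<n} \<union> ?Q) = hdet ?b {..<n} * hdet ?s ?Q"
  proof (rule hdet_schur_complement[OF b, where X = "\<lambda>q z. - H (q - n) z"])
    show "(\<Sum>z<n. - H (q - n) z * ?b z p) = - ?b q p" if "q \<in> ?Q" "p \<in> {..<n}" for q p
      using that inv by (auto simp: blocks_def sum_negf)
    show "?s q q' = ?b q q' + (\<Sum>z<n. - H (q - n) z * ?b z q')"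
      if "q \<in> ?Q" "q' \<in> ?Q" for q q'
      using that by (auto simp: blocks_def sum_negf if_distrib[of "\<lambda>c. _ * c"] cong: if_cong)
  qed auto
  then show ?thesis
    using hdet_blocks_one[OF G order.refl, of n]
    by (simp add: hdet_blocks_left hdet_blocks_right hermitian_uminus H)
qed

text \<open>Changing the diagonal entry at \<open>x\<close> in \<open>M\<close> adds a multiple of
  the determinant without \<open>x\<close>, where \<open>N\<close> outnumbers the other indices and
  forces 0.\<close>

lemma hdet_diag_add_isotropic:
  assumes b: "hermitian_form b" and M: "finite M" and N: "finite N"
    and "M \<inter> N = {}" "card M = card N"
    and iso: "\<And>u v. u \<in> N \<Longrightarrow> v \<in> N \<Longrightarrow> b u v = 0"
  shows "hdet (\<lambda>u v. b u v + (if u = v \<and> u \<in> M then - 1 else 0)) (M \<union> N) = hdet b (M \<union> N)"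
proof -
  define c where "c U u v = b u v + (if u = v \<and> u \<in> U then - 1 else 0)" for U u v
  have c: "hermitian_form (c U)" for U
    by (rule hermitian_formI)
      (auto simp: c_def conj_add hermitian_form_conj[OF b] conj_Z Z_uminus Z_add hermitian_form_diag[OF b])
  have "hdet (c U) (M \<union> N) = hdet b (M \<union> N)" if "U \<subseteq> M" for U
    using finite_subset[OF that M] that
  proof (induction U rule: finite_induct)
    case (insert x U)
    let ?S = "M - {x} \<union> N"
    have x: "x \<in> M" "x \<notin> N" "M \<union> N = insert x ?S"
      using insert.prems \<open>M \<inter> N = {}\<close> by auto
    have "card (?S - N) < card (?S \<inter> N)"
    proof -
      have "?S - N = M - {x}" "?S \<inter> N = N"
        using x \<open>M \<inter> N = {}\<close> by auto
      then show ?thesis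
        using card_Diff1_less[OF M x(1)] \<open>card M = card N\<close> by simp
    qed
    then have "hdet (c U) ?S = 0"
      using M N insert.prems \<open>M \<inter> N = {}\<close>
      by (intro hdet_large_isotropic[OF c, of _ N]) (auto simp: c_def iso)
    moreover have "hdet (c (insert x U)) (insert x ?S) = hdet (c U) (insert x ?S) + (- 1) * hdet (c U) ?S"
      using x M N insert.hyps by (intro hdet_insert_diag_add c) (auto simp: c_def)
    ultimately show ?case
      using insert.IH insert.prems by (simp only: x(3)) simp
  qed (simp add: c_def[abs_def])
  from this[of M] show ?thesis by (simp add: c_def[abs_def])
qed

text \<open>
  Both sides are, up to the same sign, the determinant of \<open>(0 A; A\<^sup>* 0)\<close>: subtracting the identity from
  one of the diagonal blocks does not change it, and then the other block can be cleared.
\<close>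

lemma hdet_gram_comm:
  fixes n :: nat
  shows "hdet (\<lambda>x y. \<Sum>z<n. conj (a z x) * a z y) {..<n} = hdet (\<lambda>x y. \<Sum>z<n. a x z * conj (a y z)) {..<n}"
    (is "hdet ?L _ = hdet ?R _")
proof -
  let ?Q = "(\<lambda>x. x + n) ` {..<n}"
  let ?J = "\<lambda>x y. if x = y then - 1 else 0 :: 'h"
  have J: "hermitian_form ?J"
    by (rule hermitian_diag) (simp add: Z_uminus)
  let ?b = "blocks n (\<lambda>_ _. 0) a (\<lambda>_ _. 0)"
  let ?l = "blocks n ?J a (\<lambda>_ _. 0)"
  let ?r = "blocks n (\<lambda>_ _. 0) a ?J"
  note herm = hermitian_blocks[OF hermitian_zero hermitian_zero]
    hermitian_blocks[OF J hermitian_zero] hermitian_blocks[OF hermitian_zero J]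
  have disj: "{..<n} \<inter> ?Q = {}" by auto
  have cardQ: "card ?Q = n" by (simp add: card_image)
  \<comment> \<open>With -1 as pivot block the elimination coefficients are the entries of the
    adjoint of \<open>a\<close>, and the two minus signs make the Schur complement equal to
    \<open>?L\<close>.\<close>
  have "hdet ?l ({..<n} \<union> ?Q) = hdet ?l {..<n} * hdet (blocks n (\<lambda>_ _. 0) (\<lambda>_ _. 0) ?L) ?Q"
  proof (rule hdet_schur_complement[OF herm(2) _ _ disj, where X = "\<lambda>q z. conj (a z (q - n))"])
    show "(\<Sum>z<n. conj (a z (q - n)) * ?l z p) = - ?l q p" if "q \<in> ?Q" "p \<in> {..<n}" for q p
      using that by (auto simp: blocks_def if_distrib[of "\<lambda>c. _ * c"] cong: if_cong)
  qed (auto simp: blocks_def)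
  then have "(- 1) ^ n * hdet ?L {..<n} = hdet ?l ({..<n} \<union> ?Q)"
    by (simp add: hdet_blocks_left hdet_blocks_right hermitian_gram_left hdet_minus_one)
  also have "\<dots> = hdet ?b ({..<n} \<union> ?Q)"
  proof -
    have "hdet (\<lambda>u v. ?b u v + (if u = v \<and> u \<in> {..<n} then - 1 else 0)) ({..<n} \<union> ?Q) = hdet ?b ({..<n} \<union> ?Q)"
      using disj cardQ by (intro hdet_diag_add_isotropic herm) (auto simp: blocks_def)
    moreover have "(\<lambda>u v. ?b u v + (if u = v \<and> u \<in> {..<n} then - 1 else 0)) = ?l"
      by (auto simp: blocks_def fun_eq_iff)
    ultimately show ?thesis by simp
  qed
  also have "\<dots> = hdet ?r (?Q \<union> {..<n})"
  proof -
    have "hdet (\<lambda>u v. ?b u v + (if u = v \<and> u \<in> ?Q then - 1 else 0)) (?Q \<union> {..<n}) = hdet ?b (?Q \<union> {..<n})"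
      using disj cardQ by (intro hdet_diag_add_isotropic herm) (auto simp: blocks_def)
    moreover have "hdet (\<lambda>u v. ?b u v + (if u = v \<and> u \<in> ?Q then - 1 else 0)) (?Q \<union> {..<n}) = hdet ?r (?Q \<union> {..<n})"
      by (rule hdet_cong) (auto simp: blocks_def)
    ultimately show ?thesis by (simp add: Un_commute)
  qed
  also have "\<dots> = hdet ?r ?Q * hdet (blocks n ?R (\<lambda>_ _. 0) (\<lambda>_ _. 0)) {..<n}"
  proof (rule hdet_schur_complement[OF herm(3), where X = "\<lambda>q z. a q (z - n)"])
    show "(\<Sum>z\<in>?Q. a q (z - n) * ?r z p) = - ?r q p" if "q \<in> {..<n}" "p \<in> ?Q" for q p
      using that
      by (auto simp: blocks_def sum.reindex if_distrib[of "\<lambda>c. _ * c"] cong: if_cong)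
    show "blocks n ?R (\<lambda>_ _. 0) (\<lambda>_ _. 0) q q' = ?r q q' + (\<Sum>z\<in>?Q. a q (z - n) * ?r z q')"
      if "q \<in> {..<n}" "q' \<in> {..<n}" for q q'
      using that by (simp add: blocks_def sum.reindex)
  qed (use disj in auto)
  also have "\<dots> = (- 1) ^ n * hdet ?R {..<n}"
    by (simp add: hdet_blocks_left hdet_blocks_right J hdet_minus_one)
  finally have "(- 1) ^ n * ((- 1) ^ n * hdet ?L {..<n}) = (- 1) ^ n * ((- 1) ^ n * hdet ?R {..<n})"
    by (simp only:)
  then show ?thesis
    by (simp add: minus_one_power_square flip: mult.assoc)
qed

end

section \<open>Row determinants as sums over paths\<close>

lemma support_orbit:
  assumes "permutation \<sigma>"
  shows "set (support \<sigma> k) = orbit \<sigma> k" "length (support \<sigma> k) = card (orbit \<sigma> k)"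
    "support \<sigma> k = k # tl (support \<sigma> k)"
proof -
  show set: "set (support \<sigma> k) = orbit \<sigma> k"
    unfolding support_set[OF assms] orbit_altdef_permutation[OF assms] by auto
  show "length (support \<sigma> k) = card (orbit \<sigma> k)"
    using distinct_card[OF cycle_of_permutation[OF assms]] set by metis
  show "support \<sigma> k = k # tl (support \<sigma> k)"
    using least_power_of_permutation(2)[OF assms, of k] by (simp add: upt_conv_Cons)
qed

section \<open>Splitting off the cycle through an index\<close>

text \<open>A permutation of \<open>S\<close> is the cycle \<open>k # xs\<close>, read from
  \<open>k\<close>, composed with a permutation \<open>\<tau>\<close> of the rest. Orbits, cycle
  products and least elements separate accordingly.\<close>

locale cycle_and_rest =
  fixes k :: nat and xs :: "nat list" and S :: "nat set" and \<tau> :: "nat \<Rightarrow> nat"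
  assumes fin: "finite S" and k: "k \<in> S" and xs: "xs \<in> paths (S - {k})"
    and \<tau>: "\<tau> permutes (S - {k} - set xs)"
begin

definition "\<sigma> = cycle_of_list (k # xs) \<circ> \<tau>"

lemma dist: "distinct (k # xs)"
  using xs by (auto simp: mem_paths)

lemma sub: "set (k # xs) \<subseteq> S"
  using xs k by (auto simp: mem_paths)

lemma permutes: "\<sigma> permutes S"
  unfolding \<sigma>_def
  by (intro permutes_compose permutes_subset[OF \<tau>] permutes_subset[OF cycle_permutes] sub) auto

lemma perm: "permutation \<sigma>"
  using permutes fin permutation_permutes by blast

lemma on_cycle: "x \<in> set (k # xs) \<Longrightarrow> \<sigma> x = cycle_of_list (k # xs) x"
  using permutes_not_in[OF \<tau>, of x] by (auto simp: \<sigma>_def)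

lemma on_rest: "x \<in> S - set (k # xs) \<Longrightarrow> \<sigma> x = \<tau> x"
  using permutes_in_image[OF \<tau>, of x] by (auto simp: \<sigma>_def intro!: id_outside_supp)

lemma funpow_on_cycle: "(\<sigma> ^^ t) k = (k # xs) ! (t mod Suc (length xs))"
proof -
  have "(cycle_of_list (k # xs) ^^ t) k = hd (rotate t (k # xs))"
    using cyclic_rotation[OF dist, of t] by (metis list.sel(1) list.simps(9))
  then have c: "(cycle_of_list (k # xs) ^^ t) k = (k # xs) ! (t mod Suc (length xs))" for t
    using cyclic_rotation[OF dist, of t] hd_rotate_conv_nth[of "k # xs" t]
    by (metis length_Cons list.distinct(1) list.sel(1) list.simps(9))
  have "(\<sigma> ^^ t) k = (cycle_of_list (k # xs) ^^ t) k"
  proof (induction t)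
    case (Suc t)
    have "(cycle_of_list (k # xs) ^^ t) k \<in> set (k # xs)"
      unfolding c by (rule nth_mem) simp
    then show ?case
      using on_cycle Suc by simp
  qed simp
  then show ?thesis by (simp only: c)
qed

lemma orbit_k: "orbit \<sigma> k = set (k # xs)"
proof -
  have "orbit \<sigma> k = {(\<sigma> ^^ m) k |m. m < Suc (length xs)}"
    by (rule orbit_altdef_bounded) (simp_all only: funpow_on_cycle, simp_all)
  also have "\<dots> = {(k # xs) ! m |m. m < length (k # xs)}"
    by (intro Collect_cong ex_cong1) (auto simp: funpow_on_cycle)
  finally show ?thesis by (simp only: set_conv_nth)
qed

lemma orbit_cycle: "m \<in> set (k # xs) \<Longrightarrow> orbit \<sigma> m = set (k # xs)"
  using orbit_cyclic_eq3[OF cyclic_on_orbit'[OF perm, of k], of m] orbit_k by simp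

lemma orbit_rest:
  assumes "m \<in> S - set (k # xs)"
  shows "orbit \<sigma> m = orbit \<tau> m" "orbit \<tau> m \<subseteq> S - set (k # xs)"
    "(\<sigma> ^^ t) m = (\<tau> ^^ t) m" "(\<tau> ^^ t) m \<in> S - set (k # xs)"
proof -
  have m: "m \<in> S - {k} - set xs" and R: "S - {k} - set xs = S - set (k # xs)"
    using assms by auto
  show "orbit \<tau> m \<subseteq> S - set (k # xs)"
    using permutes_orbit_subset[OF \<tau> m] R by simp
  have "permutation \<tau>"
    using permutation_permutes[of \<tau>] \<tau> finite_Diff[OF finite_Diff[OF fin]] by metis
  then show "orbit \<sigma> m = orbit \<tau> m"
    using \<open>orbit \<tau> m \<subseteq> S - set (k # xs)\<close>
    by (intro orbit_cong permutation_self_in_orbit on_rest) auto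
  show in_rest: "(\<tau> ^^ t) m \<in> S - set (k # xs)" for t
    using permutes_in_image[OF permutes_funpow[OF \<tau>], of t m] m R by simp
  show "(\<sigma> ^^ t) m = (\<tau> ^^ t) m"
    by (induction t) (use on_rest in_rest in auto)
qed

lemma support_k: "support \<sigma> k = k # xs"
proof -
  have "least_power \<sigma> k = length (k # xs)"
    using support_orbit(2)[OF perm, of k] distinct_card[OF dist] by (simp add: orbit_k)
  then have "support \<sigma> k = map (\<lambda>t. (k # xs) ! t) [0..<length (k # xs)]"
    by (simp add: funpow_on_cycle del: upt_Suc)
  then show ?thesis by (simp only: map_nth)
qed

lemma restrict: "perm_restrict \<sigma> (S - orbit \<sigma> k) = \<tau>"
proof
  fix x show "perm_restrict \<sigma> (S - orbit \<sigma> k) x = \<tau> x"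
    using on_rest[of x] permutes_not_in[OF \<tau>, of x] by (auto simp: perm_restrict_def orbit_k)
qed

text \<open>\<open>cycle_prod\<close> is unsigned, so the sign of \<open>walk\<close>, which is its
  own inverse, is undone. The last factor returns to \<open>k\<close>, hence \<open>xs @ [k]\<close>
  in the proof.\<close>

lemma cycle_prod_k: "cycle_prod B \<sigma> k = (- 1) ^ length xs * walk (\<lambda>x y. B $$ (x, y)) k xs k"
proof -
  have *: "walk (\<lambda>x y. B $$ (x, y)) x ys z = (- 1) ^ length ys *
      prod_list (map (\<lambda>t. B $$ ((x # ys) ! t, (ys @ [z]) ! t)) [0..<Suc (length ys)])" for x ys z
  proof (induction ys arbitrary: x)
    case (Cons y ys)
    have "[0..<Suc (length (y # ys))] = 0 # map Suc [0..<Suc (length ys)]"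
      by (simp add: upt_conv_Cons map_Suc_upt del: upt_Suc)
    moreover have "B $$ (x, y) * ((- 1) ^ length ys * p) = (- 1) ^ length ys * (B $$ (x, y) * p)" for p
      by (cases "even (length ys)") simp_all
    ultimately show ?case
      by (simp add: Cons.IH comp_def del: upt_Suc)
  qed simp
  have "cycle_prod B \<sigma> k = prod_list (map (\<lambda>t. B $$ ((k # xs) ! t, (xs @ [k]) ! t)) [0..<Suc (length xs)])"
    unfolding cycle_prod_def orbit_k distinct_card[OF dist] funpow_on_cycle
    by (intro arg_cong[of _ _ prod_list] map_cong)
      (auto simp: nth_append less_Suc_eq mod_Suc simp del: upt_Suc)
  then show ?thesis
    by (simp add: * mult.assoc[symmetric] power_mult_distrib[symmetric] flip: power_add del: upt_Suc)
qed

lemma cycle_prod_rest: "m \<in> S - set (k # xs) \<Longrightarrow> cycle_prod B \<sigma> m = cycle_prod B \<tau> m"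
  unfolding cycle_prod_def by (simp only: orbit_rest)

lemma minima_rest:
  "{m \<in> S. k \<notin> orbit \<sigma> m \<and> m = Min (orbit \<sigma> m)} = {m \<in> S - {k} - set xs. m = Min (orbit \<tau> m)}"
proof -
  have "m \<in> S \<and> k \<notin> orbit \<sigma> m \<and> m = Min (orbit \<sigma> m)
    \<longleftrightarrow> m \<in> S - {k} - set xs \<and> m = Min (orbit \<tau> m)" for m
  proof (cases "m \<in> set (k # xs)")
    case True
    then show ?thesis using orbit_cycle[of m] by auto
  next
    case False
    then show ?thesis using orbit_rest(1,2)[of m] by auto
  qed
  then show ?thesis by blast
qed

end

text \<open>The gluing map is inverted by listing the cycle through \<open>k\<close> with
  \<open>support\<close>, dropping its head \<open>k\<close>, and restricting the permutation to the
  complement of the orbit.\<close>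

lemma sum_permutations_cycle_and_rest:
  fixes S :: "nat set"
  assumes "finite S" "k \<in> S"
  shows "(\<Sum>\<sigma> | \<sigma> permutes S. f \<sigma>)
    = (\<Sum>xs\<in>paths (S - {k}). \<Sum>\<tau> | \<tau> permutes (S - {k} - set xs). f (cycle_of_list (k # xs) \<circ> \<tau>))"
proof -
  let ?I = "SIGMA xs:paths (S - {k}). {\<tau>. \<tau> permutes (S - {k} - set xs)}"
  let ?g = "\<lambda>(xs, \<tau>). cycle_of_list (k # xs) \<circ> \<tau>"
  let ?h = "\<lambda>\<sigma>. (tl (support \<sigma> k), perm_restrict \<sigma> (S - orbit \<sigma> k))"
  have cr: "cycle_and_rest k xs S \<tau>" if "(xs, \<tau>) \<in> ?I" for xs \<tau>
    using that assms by unfold_locales auto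
  have "(\<Sum>\<sigma> | \<sigma> permutes S. f \<sigma>) = (\<Sum>a\<in>?I. f (?g a))"
  proof (rule sum.reindex_bij_witness[of _ ?g ?h])
    fix a assume a: "a \<in> ?I"
    obtain xs \<tau> where [simp]: "a = (xs, \<tau>)" by (cases a)
    interpret cycle_and_rest k xs S \<tau> using a by (intro cr) simp
    show "?g a \<in> {\<sigma>. \<sigma> permutes S}"
      using permutes by (simp add: \<sigma>_def)
    show "?h (?g a) = a"
      using support_k restrict by (simp add: \<sigma>_def)
  next
    fix \<sigma> assume "\<sigma> \<in> {\<sigma>. \<sigma> permutes S}"
    then have \<sigma>: "\<sigma> permutes S" and perm: "permutation \<sigma>"
      using assms permutation_permutes by auto
    have cyc: "k # tl (support \<sigma> k) = support \<sigma> k"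
      using support_orbit(3)[OF perm] by (rule sym)
    have orb: "orbit \<sigma> k = insert k (set (tl (support \<sigma> k)))"
      using support_orbit(1)[OF perm, of k] by (metis cyc list.simps(15))
    have R: "S - {k} - set (tl (support \<sigma> k)) = S - orbit \<sigma> k"
      unfolding orb by auto
    have rest: "perm_restrict \<sigma> (S - orbit \<sigma> k) permutes (S - orbit \<sigma> k)"
      by (rule perm_restrict_diff_cyclic[OF \<sigma> cyclic_on_orbit'[OF perm]])
    moreover have "tl (support \<sigma> k) \<in> paths (S - {k})"
      using cycle_of_permutation[OF perm, of k] permutes_orbit_subset[OF \<sigma> assms(2)]
      unfolding mem_paths orb by (metis (no_types, lifting) cyc distinct.simps(2) insert_subset subset_Diff_insert Diff_empty)
    ultimately show hI: "?h \<sigma> \<in> ?I" by (simp add: R)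
    have "?g (?h \<sigma>) x = \<sigma> x" for x
    proof (cases "x \<in> orbit \<sigma> k")
      case True
      then have "x \<in> set (support \<sigma> k)" using support_orbit(1)[OF perm] by simp
      then have "\<sigma> x = cycle_of_list (support \<sigma> k) x" by (rule cycle_restrict[OF perm])
      then show ?thesis using True by (simp only: case_prod_conv cyc) (simp add: perm_restrict_def)
    next
      case False
      then have "\<sigma> x \<notin> orbit \<sigma> k"
        using cyclic_on_f_in[OF \<sigma> cyclic_on_orbit'[OF perm]] by blast
      then have "\<sigma> x \<notin> set (support \<sigma> k)" using support_orbit(1)[OF perm] by simp
      then have "cycle_of_list (support \<sigma> k) (\<sigma> x) = \<sigma> x" by (rule id_outside_supp)
      moreover have "perm_restrict \<sigma> (S - orbit \<sigma> k) x = \<sigma> x"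
        using False permutes_not_in[OF \<sigma>] by (auto simp: perm_restrict_def)
      ultimately show ?thesis by (simp only: case_prod_conv cyc comp_apply)
    qed
    then show "?g (?h \<sigma>) = \<sigma>" by (rule ext)
    then show "f (?g (?h \<sigma>)) = f \<sigma>" by (simp only:)
  qed
  also have "\<dots> = (\<Sum>xs\<in>paths (S - {k}). \<Sum>\<tau> | \<tau> permutes (S - {k} - set xs). f (cycle_of_list (k # xs) \<circ> \<tau>))"
    using assms by (subst sum.Sigma) (auto simp: finite_permutations intro!: sum.cong)
  finally show ?thesis .
qed

text \<open>The factor left over once the first cycle of a row determinant is fixed: no index is
  distinguished any more.\<close>

definition ordered_cycle_sum :: "'h::ring_1 mat \<Rightarrow> nat set \<Rightarrow> 'h" where
  "ordered_cycle_sum B S = (\<Sum>\<sigma> | \<sigma> permutes S.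
     let L = sorted_list_of_set {m \<in> S. m = Min (orbit \<sigma> m)}
     in (- 1) ^ (card S - length L) * prod_list (map (cycle_prod B \<sigma>) L))"

lemma cycle_sum_expansion:
  assumes S: "finite S" "k \<in> S"
  shows "(\<Sum>\<sigma> | \<sigma> permutes S.
      let L = k # sorted_list_of_set {m \<in> S. k \<notin> orbit \<sigma> m \<and> m = Min (orbit \<sigma> m)}
      in (- 1) ^ (card S - length L) * prod_list (map (cycle_prod B \<sigma>) L))
    = (\<Sum>xs\<in>paths (S - {k}). walk (\<lambda>x y. B $$ (x, y)) k xs k * ordered_cycle_sum B (S - {k} - set xs))"
  unfolding sum_permutations_cycle_and_rest[OF S] ordered_cycle_sum_def sum_distrib_left
proof (intro sum.cong refl)
  fix xs \<tau> assume "xs \<in> paths (S - {k})" "\<tau> \<in> {\<tau>. \<tau> permutes (S - {k} - set xs)}"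
  then interpret cycle_and_rest k xs S \<tau>
    using S by unfold_locales auto
  let ?R = "S - {k} - set xs"
  define M where "M = {m \<in> ?R. m = Min (orbit \<tau> m)}"
  have fin: "finite M" "finite ?R" using S by (simp_all add: M_def)
  have "M \<subseteq> ?R" by (auto simp: M_def)
  have "card S = Suc (length xs) + card ?R"
  proof -
    have "S = set (k # xs) \<union> ?R" "set (k # xs) \<inter> ?R = {}" using sub by auto
    then have "card S = card (set (k # xs)) + card ?R"
      using card_Un_disjoint[of "set (k # xs)" ?R] fin by simp
    then show ?thesis using distinct_card[OF dist] by simp
  qed
  \<comment> \<open>Subtraction is truncated, so the signs split only because the rest has at most
    as many cycles as elements.\<close>
  then have sign: "card S - Suc (card M) = length xs + (card ?R - card M)"
    using card_mono[OF fin(2) \<open>M \<subseteq> ?R\<close>] by simp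
  have rest: "map (cycle_prod B \<sigma>) (sorted_list_of_set M) = map (cycle_prod B \<tau>) (sorted_list_of_set M)"
    using \<open>M \<subseteq> ?R\<close> fin by (intro map_cong refl cycle_prod_rest) auto
  have signs: "(- 1) ^ (p + q) * ((- 1) ^ p * x * y) = x * ((- 1) ^ q * y)" for x y :: 'a and p q :: nat
    by (cases "even p"; cases "even q") simp_all
  show "(let L = k # sorted_list_of_set
        {m \<in> S. k \<notin> orbit (cycle_of_list (k # xs) \<circ> \<tau>) m \<and> m = Min (orbit (cycle_of_list (k # xs) \<circ> \<tau>) m)}
      in (- 1) ^ (card S - length L) * prod_list (map (cycle_prod B (cycle_of_list (k # xs) \<circ> \<tau>)) L))
    = walk (\<lambda>x y. B $$ (x, y)) k xs k * (let L = sorted_list_of_set {m \<in> ?R. m = Min (orbit \<tau> m)}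
      in (- 1) ^ (card ?R - length L) * prod_list (map (cycle_prod B \<tau>) L))"
    unfolding \<sigma>_def[symmetric] minima_rest M_def[symmetric]
    by (simp add: Let_def sign rest cycle_prod_k signs)
qed

text \<open>The cycle through \<open>Min S\<close> starts there and comes first anyway, so
  distinguishing \<open>Min S\<close> changes nothing and the recursion of \<open>hdet\<close>
  appears.\<close>

lemma ordered_cycle_sum_eq_hdet:
  "finite S \<Longrightarrow> ordered_cycle_sum B S = hdet (\<lambda>x y. B $$ (x, y)) S"
proof (induction S rule: finite_psubset_induct)
  case (psubset S)
  show ?case
  proof (cases "S = {}")
    case False
    let ?k = "Min S"
    have k: "?k \<in> S" using psubset.hyps False by simp
    have L: "sorted_list_of_set {m \<in> S. m = Min (orbit \<sigma> m)}
        = ?k # sorted_list_of_set {m \<in> S. ?k \<notin> orbit \<sigma> m \<and> m = Min (orbit \<sigma> m)}"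
      if "\<sigma> permutes S" for \<sigma>
    proof -
      let ?M = "{m \<in> S. m = Min (orbit \<sigma> m)}"
      have perm: "permutation \<sigma>" using that psubset.hyps permutation_permutes by blast
      have sub: "orbit \<sigma> m \<subseteq> S" "finite (orbit \<sigma> m)" if "m \<in> S" for m
        using permutes_orbit_subset[OF \<open>\<sigma> permutes S\<close> that] psubset.hyps finite_subset by auto
      have Min_k: "Min (orbit \<sigma> m) = ?k" if "m \<in> S" "?k \<in> orbit \<sigma> m" for m
        using sub[OF that(1)] that(2) psubset.hyps by (intro Min_eqI) (auto intro: Min_le)
      have "?k \<in> ?M"
        using k Min_k permutation_self_in_orbit[OF perm] by simp
      moreover have "Min ?M = ?k"
        using \<open>?k \<in> ?M\<close> psubset.hyps by (intro Min_eqI) auto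
      moreover have "?M - {?k} = {m \<in> S. ?k \<notin> orbit \<sigma> m \<and> m = Min (orbit \<sigma> m)}"
        using Min_k permutation_self_in_orbit[OF perm] by auto
      ultimately show ?thesis
        using psubset.hyps sorted_list_of_set_nonempty[of ?M] by auto
    qed
    have "ordered_cycle_sum B S = (\<Sum>\<sigma> | \<sigma> permutes S.
      let L = ?k # sorted_list_of_set {m \<in> S. ?k \<notin> orbit \<sigma> m \<and> m = Min (orbit \<sigma> m)}
      in (- 1) ^ (card S - length L) * prod_list (map (cycle_prod B \<sigma>) L))"
      unfolding ordered_cycle_sum_def by (intro sum.cong refl) (simp add: L)
    also have "\<dots> = bdet (\<lambda>x y. B $$ (x, y)) (S - {?k}) ?k ?k"
      unfolding cycle_sum_expansion[OF psubset.hyps k] bdet_def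
    proof (intro sum.cong refl)
      fix xs
      have "S - {?k} - set xs \<subset> S" using k by auto
      from psubset.IH[OF this]
      show "walk (\<lambda>x y. B $$ (x, y)) ?k xs ?k * ordered_cycle_sum B (S - {?k} - set xs)
        = walk (\<lambda>x y. B $$ (x, y)) ?k xs ?k * hdet (\<lambda>x y. B $$ (x, y)) (S - {?k} - set xs)" by simp
    qed
    also have "\<dots> = hdet (\<lambda>x y. B $$ (x, y)) S"
      by (rule hdet_Min[OF psubset.hyps False, symmetric])
    finally show ?thesis .
  qed (simp add: ordered_cycle_sum_def)
qed

lemma rdet_eq_bdet:
  assumes "k < dim_row B"
  shows "rdet k B = bdet (\<lambda>x y. B $$ (x, y)) ({..<dim_row B} - {k}) k k"
  using cycle_sum_expansion[of "{..<dim_row B}" k B] assms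
  by (simp add: rdet_def cycle_starts_def Let_def bdet_def ordered_cycle_sum_eq_hdet lessThan_atLeast0)

context central_involution
begin

section \<open>Adjoints and column determinants\<close>

definition star :: "'h mat \<Rightarrow> 'h mat" where
  "star A = map_mat conj (transpose_mat A)"

lemma star_carrier [simp]: "A \<in> carrier_mat n m \<Longrightarrow> star A \<in> carrier_mat m n"
  by (simp add: star_def)

lemma dim_star [simp]: "dim_row (star A) = dim_col A" "dim_col (star A) = dim_row A"
  by (simp_all add: star_def)

lemma star_index [simp]: "r < dim_col A \<Longrightarrow> c < dim_row A \<Longrightarrow> star A $$ (r, c) = conj (A $$ (c, r))"
  by (simp add: star_def)

lemma star_star [simp]: "star (star A) = A"
  by (rule eq_matI) auto

lemma star_mult:
  assumes "A \<in> carrier_mat n m" "B \<in> carrier_mat m l"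
  shows "star (A * B) = star B * star A"
  by (rule eq_matI)
    (use assms in \<open>auto simp: scalar_prod_def conj_sum conj_mult intro!: sum.cong\<close>)

text \<open>Conjugation reverses the factors and transposes their indices, so the cycle is traversed
  backwards from the same index \<open>m\<close>.\<close>

lemma conj_cycle_prod:
  assumes B: "B \<in> carrier_mat n n" and \<sigma>: "\<sigma> permutes {0..<n}" and m: "m < n"
  shows "conj (cycle_prod B \<sigma> m) = cycle_prod (star B) (inv_into UNIV \<sigma>) m"
proof -
  have perm: "permutation \<sigma>"
    using \<sigma> permutation_permutes by blast
  define c where "c = card (orbit \<sigma> m)"
  have "least_power \<sigma> m = c"
    using support_orbit(2)[OF perm, of m] by (simp add: c_def)
  then have c: "(\<sigma> ^^ c) m = m"
    using least_power_of_permutation(1)[OF perm, of m] by simp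
  have lt: "(\<sigma> ^^ t) m < n" for t
    using permutes_in_image[OF permutes_funpow[OF \<sigma>], of t m] m by simp
  \<comment> \<open>Going back \<open>t\<close> steps is going forward \<open>c - t\<close> steps on
    a cycle of length \<open>c\<close>.\<close>
  have inv: "(inv_into UNIV \<sigma> ^^ t) m = (\<sigma> ^^ (c - t)) m" if "t \<le> c" for t
    using that
  proof (induction t)
    case (Suc t)
    then have "(inv_into UNIV \<sigma> ^^ Suc t) m = inv_into UNIV \<sigma> ((\<sigma> ^^ Suc (c - Suc t)) m)"
      by (simp add: Suc_diff_Suc del: funpow.simps(2)) simp
    then show ?case
      using permutes_inverses(2)[OF \<sigma>] by simp
  qed (simp add: c)
  have "conj (cycle_prod B \<sigma> m)
    = prod_list (rev (map (\<lambda>t. conj (B $$ ((\<sigma> ^^ t) m, (\<sigma> ^^ Suc t) m))) [0..<c]))"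
    by (simp add: cycle_prod_def conj_prod_list c_def comp_def)
  also have "rev (map (\<lambda>t. conj (B $$ ((\<sigma> ^^ t) m, (\<sigma> ^^ Suc t) m))) [0..<c])
    = map (\<lambda>t. star B $$ ((inv_into UNIV \<sigma> ^^ t) m, (inv_into UNIV \<sigma> ^^ Suc t) m)) [0..<c]"
  proof (rule nth_equalityI)
    fix t assume "t < length (rev (map (\<lambda>t. conj (B $$ ((\<sigma> ^^ t) m, (\<sigma> ^^ Suc t) m))) [0..<c]))"
    then have t: "t < c" by simp
    have "star B $$ ((\<sigma> ^^ (c - t)) m, (\<sigma> ^^ (c - Suc t)) m)
        = conj (B $$ ((\<sigma> ^^ (c - Suc t)) m, (\<sigma> ^^ (c - t)) m))"
      using B lt by simp
    moreover have "Suc (c - Suc t) = c - t" using t by simp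
    ultimately show "rev (map (\<lambda>t. conj (B $$ ((\<sigma> ^^ t) m, (\<sigma> ^^ Suc t) m))) [0..<c]) ! t
        = map (\<lambda>t. star B $$ ((inv_into UNIV \<sigma> ^^ t) m, (inv_into UNIV \<sigma> ^^ Suc t) m)) [0..<c] ! t"
      using t inv[of t] inv[of "Suc t"] by (simp add: rev_nth del: funpow.simps(2))
  qed simp
  also have "prod_list \<dots> = cycle_prod (star B) (inv_into UNIV \<sigma>) m"
    by (simp add: cycle_prod_def c_def orbit_inv_eq[OF perm])
  finally show ?thesis .
qed

text \<open>A permutation and its inverse have the same orbits, hence the same starting indices;
  conjugation produces the reversed order of the cycles.\<close>

lemma cdet_eq_conj_rdet:
  assumes B: "B \<in> carrier_mat n n" and k: "k < n"
  shows "cdet k B = conj (rdet k (star B))"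
proof -
  have dims: "dim_row B = n" "dim_row (star B) = n" using B by auto
  let ?L = "cycle_starts n k"
  have "conj (rdet k (star B)) = (\<Sum>\<sigma> | \<sigma> permutes {0..<n}.
      conj ((- 1) ^ (n - length (?L (inv_into UNIV \<sigma>))) * prod_list (map (cycle_prod (star B) (inv_into UNIV \<sigma>)) (?L (inv_into UNIV \<sigma>)))))"
    unfolding rdet_def dims conj_sum by (rule sum_permutations_inverse)
  also have "\<dots> = cdet k B"
    unfolding cdet_def dims
  proof (intro sum.cong refl)
    fix \<sigma> assume "\<sigma> \<in> {\<sigma>. \<sigma> permutes {0..<n}}"
    then have \<sigma>: "\<sigma> permutes {0..<n}" and perm: "permutation \<sigma>"
      using permutation_permutes by auto
    have L: "?L (inv_into UNIV \<sigma>) = ?L \<sigma>"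
      by (simp add: cycle_starts_def orbit_inv_eq[OF perm])
    have "set (?L \<sigma>) \<subseteq> {..<n}"
      using k by (auto simp: cycle_starts_def)
    then have "map (\<lambda>m. conj (cycle_prod (star B) (inv_into UNIV \<sigma>) m)) (?L \<sigma>) = map (cycle_prod B \<sigma>) (?L \<sigma>)"
      by (intro map_cong refl) (auto simp: conj_cycle_prod[OF B \<sigma>, symmetric])
    then have "conj (prod_list (map (cycle_prod (star B) (inv_into UNIV \<sigma>)) (?L \<sigma>)))
        = prod_list (map (cycle_prod B \<sigma>) (rev (?L \<sigma>)))"
      by (simp only: conj_prod_list map_map comp_def rev_map[symmetric])
    then show "conj ((- 1) ^ (n - length (?L (inv_into UNIV \<sigma>))) * prod_list (map (cycle_prod (star B) (inv_into UNIV \<sigma>)) (?L (inv_into UNIV \<sigma>))))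
        = (- 1) ^ (n - length (?L \<sigma>)) * prod_list (map (cycle_prod B \<sigma>) (rev (?L \<sigma>)))"
      by (cases "even (n - length (?L \<sigma>))") (simp_all add: L conj_uminus)
  qed
  finally show ?thesis by (rule sym)
qed

section \<open>Cofactors of Gram matrices\<close>

text \<open>The coefficient of the entry in column \<open>y\<close> of row \<open>p\<close>. For
  \<open>y = p\<close> the index \<open>p\<close> is a fixed point; otherwise a path from
  \<open>y\<close> back to \<open>p\<close> completes the cycle, and the minus is the sign of its
  first step.\<close>

definition row_cofactor :: "nat \<Rightarrow> (nat \<Rightarrow> nat \<Rightarrow> 'h) \<Rightarrow> nat \<Rightarrow> nat \<Rightarrow> 'h" where
  "row_cofactor n g y p = (if y = p then hdet g ({..<n} - {p}) else - bdet g ({..<n} - {p} - {y}) y p)"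

lemma sum_row_cofactor:
  assumes "p < n"
  shows "(\<Sum>y<n. u y * row_cofactor n g y p)
    = u p * hdet g ({..<n} - {p}) - (\<Sum>y\<in>{..<n} - {p}. u y * bdet g ({..<n} - {p} - {y}) y p)"
  using assms
  by (simp add: row_cofactor_def sum.remove[of "{..<n}" p] sum_negf)

text \<open>For \<open>x\<close> different from \<open>p\<close> the sum is a minor in which row
  \<open>x\<close> occurs twice.\<close>

lemma row_cofactor_orthogonal:
  assumes g: "hermitian_form g" and "x < n" "p < n"
  shows "(\<Sum>y<n. g x y * row_cofactor n g y p) = (if x = p then hdet g {..<n} else 0)"
proof -
  have "(\<Sum>y<n. g x y * row_cofactor n g y p) = bdet g ({..<n} - {p}) x p"
    using \<open>p < n\<close> by (simp add: sum_row_cofactor bdet_rec[of "{..<n} - {p}"])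
  then show ?thesis
    using assms bdet_row_eq_0[OF g, of "{..<n} - {p}" x p] hdet_central_and_expansion[OF g, of "{..<n}"]
    by auto
qed

lemma rdet_hermitian:
  assumes "B \<in> carrier_mat n n" "hermitian_form g" "k < n"
    and "\<And>x y. x < n \<Longrightarrow> y < n \<Longrightarrow> B $$ (x, y) = g x y"
  shows "rdet k B = hdet g {..<n}"
proof -
  have "rdet k B = bdet g ({..<n} - {k}) k k"
    using assms by (subst rdet_eq_bdet) (auto intro!: bdet_cong)
  then show ?thesis
    using assms hdet_central_and_expansion[of g "{..<n}"] by auto
qed

text \<open>Row \<open>p\<close> supplies only the leftmost factor of each term, so the cofactors of
  the original matrix appear even though the changed matrix need not be Hermitian.\<close>

lemma rdet_replace_row:
  assumes B: "B \<in> carrier_mat n n" and p: "p < n"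
    and g: "\<And>x y. x < n \<Longrightarrow> y < n \<Longrightarrow> B $$ (x, y) = g x y"
  shows "rdet p (replace_row B v p) = (\<Sum>y<n. v $ y * row_cofactor n g y p)"
proof -
  let ?b = "\<lambda>x y. replace_row B v p $$ (x, y)"
  let ?T = "{..<n} - {p}"
  have b: "?b x y = (if x = p then v $ y else g x y)" if "x < n" "y < n" for x y
    using that B g by (simp add: replace_row_def)
  have "rdet p (replace_row B v p) = bdet ?b ?T p p"
    using B p by (subst rdet_eq_bdet) (simp_all add: replace_row_def)
  also have "\<dots> = v $ p * hdet ?b ?T - (\<Sum>y\<in>?T. v $ y * bdet ?b (?T - {y}) y p)"
    using p by (subst bdet_rec) (simp_all add: b)
  also have "hdet ?b ?T = hdet g ?T"
    by (rule hdet_cong) (simp add: b)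
  also have "(\<Sum>y\<in>?T. v $ y * bdet ?b (?T - {y}) y p) = (\<Sum>y\<in>?T. v $ y * bdet g (?T - {y}) y p)"
    using p by (intro sum.cong refl arg_cong2[of _ _ _ _ "(*)"] bdet_cong) (auto simp: b)
  finally show ?thesis by (simp add: sum_row_cofactor p)
qed

definition gram_det :: "nat \<Rightarrow> 'h mat \<Rightarrow> 'h" where
  "gram_det n A = hdet (\<lambda>x y. \<Sum>z<n. A $$ (x, z) * conj (A $$ (y, z))) {..<n}"

lemma gram_index:
  assumes "A \<in> carrier_mat n n" "x < n" "y < n"
  shows "(A * star A) $$ (x, y) = (\<Sum>z<n. A $$ (x, z) * conj (A $$ (y, z)))"
  using assms by (simp add: scalar_prod_def lessThan_atLeast0)

lemma gram_carrier: "A \<in> carrier_mat n n \<Longrightarrow> A * star A \<in> carrier_mat n n"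
  by simp

lemma gram_det_Z: "gram_det n A \<in> Z"
  unfolding gram_det_def by (intro hdet_Z hermitian_gram_right) simp

lemma rdet_gram:
  assumes "A \<in> carrier_mat n n" "k < n"
  shows "rdet k (A * star A) = gram_det n A"
  unfolding gram_det_def
  by (rule rdet_hermitian[OF gram_carrier[OF assms(1)] hermitian_gram_right assms(2)])
    (rule gram_index[OF assms(1)])

lemma cdet_gram:
  assumes A: "A \<in> carrier_mat n n" and k: "k < n"
  shows "cdet k (A * star A) = gram_det n A"
  using cdet_eq_conj_rdet[OF gram_carrier[OF A] k] star_mult[OF A star_carrier[OF A]]
  by (simp add: rdet_gram[OF A k] conj_Z[OF gram_det_Z])

text \<open>With the cofactor matrix \<open>?C\<close>, the product \<open>A * star A * ?C\<close>
  is scalar. Multiplying by \<open>B\<close> from the left leaves \<open>star A * ?C\<close>, whose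
  entry at \<open>(q, p)\<close> is the expansion of the replaced row.\<close>

lemma rdet_replace_row_gram:
  assumes A: "A \<in> carrier_mat n n" and B: "B \<in> carrier_mat n n" and BA: "B * A = 1\<^sub>m n"
    and p: "p < n" and q: "q < n"
  shows "rdet p (replace_row (A * star A) (row (star A) q) p) = gram_det n A * B $$ (q, p)"
proof -
  let ?g = "\<lambda>x y. \<Sum>z<n. A $$ (x, z) * conj (A $$ (y, z))"
  let ?C = "mat n n (\<lambda>(y, p). row_cofactor n ?g y p)"
  have C: "?C \<in> carrier_mat n n" and A': "star A \<in> carrier_mat n n" using A by simp_all
  have "(A * star A) * ?C = mat n n (\<lambda>(x, y). if x = y then gram_det n A else 0)"
  proof (rule eq_matI)
    fix x y assume "x < dim_row (mat n n (\<lambda>(x, y). if x = y then gram_det n A else 0))"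
      "y < dim_col (mat n n (\<lambda>(x, y). if x = y then gram_det n A else 0))"
    then have "x < n" "y < n" by simp_all
    then have "((A * star A) * ?C) $$ (x, y) = (\<Sum>z<n. ?g x z * row_cofactor n ?g z y)"
      using A gram_carrier[OF A] by (simp add: scalar_prod_def lessThan_atLeast0 gram_index[OF A] del: index_mult_mat(1))
        (simp add: scalar_prod_def gram_index[OF A, unfolded lessThan_atLeast0])
    also have "\<dots> = (if x = y then gram_det n A else 0)"
      unfolding gram_det_def
      by (rule row_cofactor_orthogonal[OF hermitian_gram_right \<open>x < n\<close> \<open>y < n\<close>])
    finally show "((A * star A) * ?C) $$ (x, y) = mat n n (\<lambda>(x, y). if x = y then gram_det n A else 0) $$ (x, y)"
      using \<open>x < n\<close> \<open>y < n\<close> by simp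
  qed (use A in auto)
  moreover have "B * ((A * star A) * ?C) = star A * ?C"
  proof -
    have "B * ((A * star A) * ?C) = (B * A) * (star A * ?C)"
      by (simp only: assoc_mult_mat[OF A A' C] assoc_mult_mat[OF B A mult_carrier_mat[OF A' C]])
    then show ?thesis
      unfolding BA by (simp only: left_mult_one_mat[OF mult_carrier_mat[OF A' C]])
  qed
  ultimately have eq: "star A * ?C = B * mat n n (\<lambda>(x, y). if x = y then gram_det n A else 0)"
    by simp
  have "rdet p (replace_row (A * star A) (row (star A) q) p) = (star A * ?C) $$ (q, p)"
    using A p q by (simp add: rdet_replace_row[OF gram_carrier[OF A] p gram_index[OF A]] scalar_prod_def lessThan_atLeast0)
  also have "\<dots> = (\<Sum>z<n. B $$ (q, z) * (if z = p then gram_det n A else 0))"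
    unfolding eq using B p q by (simp add: scalar_prod_def lessThan_atLeast0)
  also have "\<dots> = B $$ (q, p) * gram_det n A"
    using p by (simp add: if_distrib[of "\<lambda>c. _ * c"] cong: if_cong)
  finally show ?thesis by (simp only: Z_central[OF gram_det_Z])
qed

text \<open>\<open>star B * B\<close> is a left inverse of \<open>A * star A\<close>, and both are
  Gram matrices, so \<open>hdet_times_inverse\<close> applies.\<close>

lemma gram_det_invertible:
  assumes A: "A \<in> carrier_mat n n" and B: "B \<in> carrier_mat n n"
    and AB: "A * B = 1\<^sub>m n" and BA: "B * A = 1\<^sub>m n"
  shows "\<exists>u. gram_det n A * u = (- 1) ^ n"
proof -
  let ?H = "\<lambda>x y. \<Sum>z<n. conj (B $$ (z, x)) * B $$ (z, y)"
  have H: "(star B * B) $$ (x, y) = ?H x y" if "x < n" "y < n" for x y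
    using that B by (simp add: scalar_prod_def lessThan_atLeast0)
  have "(star B * B) * (A * star A) = star B * ((B * A) * star A)"
    using A B by (simp add: assoc_mult_mat[of _ n n _ n _ n])
  also have "\<dots> = star (A * B)"
    using star_mult[OF A B] BA A by simp
  also have "\<dots> = 1\<^sub>m n"
    unfolding AB by (rule eq_matI) auto
  finally have "(star B * B) * (A * star A) = 1\<^sub>m n" .
  then have "((star B * B) * (A * star A)) $$ (x, y) = (if x = y then 1 else 0)" if "x < n" "y < n" for x y
    using that by simp
  moreover have "((star B * B) * (A * star A)) $$ (x, y) = (\<Sum>z<n. (star B * B) $$ (x, z) * (A * star A) $$ (z, y))"
    if "x < n" "y < n" for x y
    using that A B by (subst index_mult_mat) (auto simp: scalar_prod_def lessThan_atLeast0 simp del: index_mult_mat(1))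
  ultimately have "hdet (\<lambda>x y. \<Sum>z<n. A $$ (x, z) * conj (A $$ (y, z))) {..<n} * hdet (\<lambda>x y. - ?H x y) {..<n} = (- 1) ^ n"
    by (intro hdet_times_inverse hermitian_gram_left hermitian_gram_right)
      (simp add: H gram_index[OF A] del: index_mult_mat)
  then show ?thesis unfolding gram_det_def by blast
qed

end

section \<open>Quaternion algebras\<close>

lemma ring_inv_eqI:
  assumes "x * y = 1" "y * x = (1 :: 'h::ring_1)"
  shows "ring_inv x = y"
proof -
  have "z = y" if "x * z = 1" for z
  proof -
    have "(y * x) * z = y * (x * z)" by (rule mult.assoc)
    then show ?thesis unfolding assms that by simp
  qed
  then have "(THE z. x * z = 1 \<and> z * x = 1) = y"
    using assms by (intro the_equality) blast+
  then show ?thesis using assms by (auto simp: ring_inv_def invertible_elem_def)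
qed

lemma mat_inv_eq:
  assumes "A \<in> carrier_mat n n" "inverts_mat A B" "inverts_mat B A"
  shows "mat_inv A = B" "B \<in> carrier_mat n n" "A * B = 1\<^sub>m n" "B * A = 1\<^sub>m n"
proof -
  have carrier: "C \<in> carrier_mat n n \<and> A * C = 1\<^sub>m n \<and> C * A = 1\<^sub>m n"
    if "inverts_mat A C" "inverts_mat C A" for C
  proof -
    have AC: "A * C = 1\<^sub>m n" and CA: "C * A = 1\<^sub>m (dim_row C)"
      using that assms(1) by (auto simp: inverts_mat_def)
    \<comment> \<open>The two products are known to be identity matrices; comparing their column
      counts fixes the shape of \<open>C\<close>.\<close>
    have "dim_col C = n" "dim_row C = n"
      using arg_cong[OF AC, of dim_col] arg_cong[OF CA, of dim_col] assms(1) by simp_all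
    then show ?thesis using AC CA by auto
  qed
  from carrier[OF assms(2,3)] show B: "B \<in> carrier_mat n n" "A * B = 1\<^sub>m n" "B * A = 1\<^sub>m n"
    by auto
  have "C = B" if "inverts_mat A C \<and> inverts_mat C A" for C
  proof -
    have C: "C \<in> carrier_mat n n" "A * C = 1\<^sub>m n"
      using carrier[of C] that by auto
    have "C = (B * A) * C" unfolding B(3) using C(1) by simp
    also have "\<dots> = B * (A * C)" by (rule assoc_mult_mat[OF B(1) assms(1) C(1)])
    also have "\<dots> = B" unfolding C(2) using B(1) by simp
    finally show ?thesis .
  qed
  then show "mat_inv A = B"
    unfolding mat_inv_def using assms(2,3) by (intro the_equality) blast+
qed

context quaternion_algebra
begin

definition quat :: "'f \<Rightarrow> 'f \<Rightarrow> 'f \<Rightarrow> 'f \<Rightarrow> 'h" where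
  "quat x0 x1 x2 x3 = scale x0 1 + scale x1 i + scale x2 j + scale x3 (i * j)"

abbreviation qc :: "'h \<Rightarrow> 'h" where "qc \<equiv> qconj scale i j"

lemma products:
  "i * (i * j) = scale a j" "(i * j) * i = - scale a j"
  "j * (i * j) = - scale b i" "(i * j) * j = scale b i"
  "(i * j) * (i * j) = - scale (a * b) 1"
proof -
  show iij: "i * (i * j) = scale a j"
    by (simp add: i_square scale_mult_left flip: mult.assoc)
  show iji: "(i * j) * i = - scale a j"
    using iij by (simp add: mult.assoc j_i)
  show "j * (i * j) = - scale b i"
    by (simp add: j_i j_square scale_mult_right mult.assoc flip: mult.assoc[of j i j])
  show ijj: "(i * j) * j = scale b i"
    by (simp add: mult.assoc j_square scale_mult_right)
  have "(i * j) * (i * j) = ((i * j) * i) * j" by (simp add: mult.assoc)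
  then show "(i * j) * (i * j) = - scale (a * b) 1"
    by (simp add: iji scale_mult_left j_square)
qed

lemma quat_exhaust:
  obtains x0 x1 x2 x3 where "x = quat x0 x1 x2 x3"
proof -
  have d: "distinct [1, i, j, i * j]" by (rule basis_distinct)
  have "x = (\<Sum>v | representation {1, i, j, i * j} x v \<noteq> 0. scale (representation {1, i, j, i * j} x v) v)"
    using sum_nonzero_representation_eq[OF basis_independent, of x] by (simp add: basis_span)
  also have "\<dots> = (\<Sum>v\<in>{1, i, j, i * j}. scale (representation {1, i, j, i * j} x v) v)"
    using representation_ne_zero by (intro sum.mono_neutral_left) auto
  also have "\<dots> = quat (representation {1, i, j, i * j} x 1) (representation {1, i, j, i * j} x i)
      (representation {1, i, j, i * j} x j) (representation {1, i, j, i * j} x (i * j))"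
    using d by (simp add: quat_def add.assoc)
  finally show ?thesis by (rule that)
qed

lemma qc_quat: "qc (quat x0 x1 x2 x3) = quat x0 (- x1) (- x2) (- x3)"
proof -
  let ?B = "{1, i, j, i * j}"
  have sp: "u \<in> span ?B" for u by (simp add: basis_span)
  have "representation ?B (quat x0 x1 x2 x3) 1 = x0"
    using basis_distinct
    by (simp add: quat_def representation_add[OF basis_independent sp sp]
        representation_scale[OF basis_independent sp] representation_basis[OF basis_independent])
  moreover have "scale (2 * x0) 1 = scale x0 1 + scale x0 1"
    by (simp only: mult_2 scale_left_distrib)
  ultimately show ?thesis
    by (simp add: qconj_def qtrace_def) (simp add: quat_def)
qed

lemma quat_mult:
  "quat x0 x1 x2 x3 * quat y0 y1 y2 y3 = quat
     (x0 * y0 + a * (x1 * y1) + b * (x2 * y2) - a * b * (x3 * y3))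
     (x0 * y1 + x1 * y0 - b * (x2 * y3) + b * (x3 * y2))
     (x0 * y2 + x2 * y0 + a * (x1 * y3) - a * (x3 * y1))
     (x0 * y3 + x3 * y0 + x1 * y2 - x2 * y1)"
proof -
  show ?thesis
    unfolding quat_def distrib_left distrib_right scale_mult_left scale_mult_right scale_scale
      scale_left_distrib scale_left_diff_distrib products i_square j_square j_i mult_1_left mult_1_right
      scale_minus_right
    by (simp add: algebra_simps)
qed

lemma quat_add: "quat x0 x1 x2 x3 + quat y0 y1 y2 y3 = quat (x0 + y0) (x1 + y1) (x2 + y2) (x3 + y3)"
  by (simp add: quat_def scale_left_distrib algebra_simps)

lemma quat_scalar: "quat x0 0 0 0 = scale x0 1"
  by (simp add: quat_def)

text \<open>All laws are polynomial identities in coordinates; the norm is x0^2 - a x1^2 - b x2^2 +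
  a b x3^2.\<close>

sublocale central_involution qc "range (\<lambda>c. scale c 1)"
proof
  fix x y :: 'h
  obtain x0 x1 x2 x3 where x: "x = quat x0 x1 x2 x3" by (rule quat_exhaust)
  obtain y0 y1 y2 y3 where y: "y = quat y0 y1 y2 y3" by (rule quat_exhaust)
  show "qc (x + y) = qc x + qc y"
    by (simp add: x y quat_add qc_quat)
  show "qc (x * y) = qc y * qc x"
    by (simp add: x y quat_mult qc_quat algebra_simps)
  show "qc (qc x) = x"
    by (simp add: x qc_quat)
  have "x + qc x = scale (x0 + x0) 1"
    by (simp add: x quat_add qc_quat flip: quat_scalar)
  then show "x + qc x \<in> range (\<lambda>c. scale c 1)" by blast
  have "x * qc x = scale (x0 * x0 - a * (x1 * x1) - b * (x2 * x2) + a * b * (x3 * x3)) 1"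
    by (simp add: x quat_mult qc_quat algebra_simps flip: quat_scalar)
  then show "x * qc x \<in> range (\<lambda>c. scale c 1)" by blast
next
  show "1 \<in> range (\<lambda>c. scale c 1)"
    by (rule range_eqI[of _ _ 1]) simp
  fix x y z :: 'h assume z: "z \<in> range (\<lambda>c. scale c 1)"
  then show "z * x = x * z"
    by (auto simp: scale_mult_left scale_mult_right)
  show "qc z = z"
    using z by (auto simp: qc_quat simp flip: quat_scalar)
  assume x: "x \<in> range (\<lambda>c. scale c 1)"
  then show "x - z \<in> range (\<lambda>c. scale c 1)" "x * z \<in> range (\<lambda>c. scale c 1)"
    using z by (auto simp: scale_mult_left simp flip: scale_left_diff_distrib)
qed

section \<open>Norms and inverses of quaternions\<close>

lemma one_nonzero: "1 \<noteq> (0 :: 'h)"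
  using basis_independent dependent_zero by auto

lemma scalar_eq_iff: "scale c 1 = scale d (1 :: 'h) \<longleftrightarrow> c = d"
  using one_nonzero by simp

lemma scalar_qnorm: "scale (qnorm scale i j x) 1 = x * qc x"
proof -
  obtain c where c: "x * qc x = scale c 1"
    using norm_Z[of x] by blast
  then have "qnorm scale i j x = c"
    unfolding qnorm_def by (intro the_equality) (simp_all add: scalar_eq_iff)
  then show ?thesis using c by simp
qed

text \<open>An element of norm 0 has no inverse, and then both sides are 0 because of the default
  value of \<open>ring_inv\<close> and division by 0.\<close>

lemma ring_inv_eq_qconj: "ring_inv x = scale (1 / qnorm scale i j x) (qc x)"
proof (cases "qnorm scale i j x = 0")
  case True
  have "\<not> invertible_elem x"
  proof
    assume "invertible_elem x"
    then obtain y where "x * y = 1" "y * x = 1"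
      by (auto simp: invertible_elem_def)
    then have "qc x * qc y = 1"
      using conj_mult[of y x] by simp
    \<comment> \<open>An inverse \<open>y\<close> would exhibit 1 as a multiple of the norm of
      \<open>x\<close>.\<close>
    have "1 = (y * (x * qc x)) * qc y"
      using \<open>y * x = 1\<close> \<open>qc x * qc y = 1\<close> by (metis mult.assoc mult_1_right)
    then show False
      using True one_nonzero by (simp flip: scalar_qnorm)
  qed
  then show ?thesis using True by (simp add: ring_inv_def)
next
  case False
  have "x * qc x = scale (qnorm scale i j x) 1" "qc x * x = scale (qnorm scale i j x) 1"
    using scalar_qnorm[of x] norm_comm[of x] by simp_all
  then show ?thesis
    using False by (intro ring_inv_eqI) (simp_all add: scale_mult_left scale_mult_right)
qed

text \<open>Double cofactors are nonzero scalar multiples of entries of the inverse matrix; this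
  carries both definedness and value across the scalar.\<close>

lemma ring_inv_scale:
  assumes "d \<noteq> 0"
  shows "invertible_elem (scale d x) \<longleftrightarrow> invertible_elem x"
    "scale d (ring_inv (scale d x)) = ring_inv x"
proof -
  have inv: "invertible_elem (scale c y)" if y: "invertible_elem y" "c \<noteq> 0" for c y
  proof -
    obtain z where "y * z = 1" "z * y = 1"
      using y(1) by (auto simp: invertible_elem_def)
    then have "scale c y * scale (1 / c) z = 1" "scale (1 / c) z * scale c y = 1"
      using y(2) by (simp_all add: scale_mult_left scale_mult_right)
    then show ?thesis by (auto simp: invertible_elem_def)
  qed
  show iff: "invertible_elem (scale d x) \<longleftrightarrow> invertible_elem x"
    using inv[of x d] inv[of "scale d x" "1 / d"] assms by auto
  show "scale d (ring_inv (scale d x)) = ring_inv x"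
  proof (cases "invertible_elem x")
    case True
    then obtain z where z: "x * z = 1" "z * x = 1"
      by (auto simp: invertible_elem_def)
    then have "ring_inv (scale d x) = scale (1 / d) z"
      using assms by (intro ring_inv_eqI) (simp_all add: scale_mult_left scale_mult_right)
    then show ?thesis
      using assms ring_inv_eqI[OF z] by simp
  qed (simp add: ring_inv_def iff)
qed

end

section \<open>Quasideterminants through double cofactors\<close>

lemma (in central_involution) gram_det_star:
  assumes "A \<in> carrier_mat n n"
  shows "gram_det n (star A) = gram_det n A"
proof -
  have "gram_det n (star A) = hdet (\<lambda>x y. \<Sum>z<n. conj (A $$ (z, x)) * A $$ (z, y)) {..<n}"
    unfolding gram_det_def using assms by (intro hdet_cong) simp
  also have "\<dots> = gram_det n A"
    unfolding gram_det_def by (rule hdet_gram_comm)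
  finally show ?thesis .
qed

text \<open>Taking adjoints turns the replaced column into a replaced row for \<open>star A\<close>,
  whose inverse is \<open>star B\<close>. Conjugating the row formula leads from entry
  \<open>(p, q)\<close> of \<open>star B\<close> back to entry \<open>(q, p)\<close> of
  \<open>B\<close>.\<close>

lemma (in central_involution) cdet_replace_col_gram:
  assumes A: "A \<in> carrier_mat n n" and B: "B \<in> carrier_mat n n"
    and AB: "A * B = 1\<^sub>m n" and p: "p < n" and q: "q < n"
  shows "cdet q (replace_col (star A * A) (col (star A) p) q) = gram_det n A * B $$ (q, p)"
proof -
  let ?A = "star A" and ?B = "star B"
  have one: "star (1\<^sub>m n) = 1\<^sub>m n"
    by (rule eq_matI) auto
  have A': "?A \<in> carrier_mat n n" and B': "?B \<in> carrier_mat n n"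
    using A B by simp_all
  have B'A': "?B * ?A = 1\<^sub>m n"
    using star_mult[OF A B] AB one by simp
  have M: "replace_col (?A * A) (col ?A p) q \<in> carrier_mat n n"
    using A by (simp add: replace_col_def)
  have "star (replace_col (?A * A) (col ?A p) q) = replace_row (?A * star ?A) (row (star ?A) p) q"
  proof (rule eq_matI)
    fix x y assume "x < dim_row (replace_row (?A * star ?A) (row (star ?A) p) q)"
      "y < dim_col (replace_row (?A * star ?A) (row (star ?A) p) q)"
    then have xy: "x < n" "y < n" using A by (simp_all add: replace_row_def)
    have "conj ((?A * A) $$ (y, x)) = (?A * A) $$ (x, y)"
      using star_index[of x "?A * A" y] star_mult[OF A' A] xy A by simp
    then show "star (replace_col (?A * A) (col ?A p) q) $$ (x, y)
        = replace_row (?A * star ?A) (row (star ?A) p) q $$ (x, y)"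
      using xy A p q by (simp add: replace_row_def replace_col_def del: index_mult_mat(1))
  qed (use A in \<open>simp_all add: replace_row_def replace_col_def\<close>)
  then have "cdet q (replace_col (?A * A) (col ?A p) q) = conj (gram_det n ?A * ?B $$ (p, q))"
    using cdet_eq_conj_rdet[OF M q] rdet_replace_row_gram[OF A' B' B'A' q p] by simp
  also have "\<dots> = gram_det n ?A * B $$ (q, p)"
    using B p q Z_central[OF gram_det_Z[of n ?A], of "B $$ (q, p)"]
    by (simp add: conj_mult conj_Z gram_det_Z)
  finally show ?thesis by (simp add: gram_det_star[OF A])
qed


theorem theorem7p1:
  fixes scale :: "'f::field \<Rightarrow> 'h::ring_1 \<Rightarrow> 'h"
    and a b :: 'f and i j :: 'h
    and A :: "'h mat" and n p q :: nat
  assumes "quaternion_algebra scale a b i j"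
    and "A \<in> carrier_mat n n"
    and "invertible_mat A"
    and "p < n" and "q < n"
  shows
    "(let A' = adjoint scale i j A;
          c = cdet q (replace_col (A' * A) (col A' p) q);
          r = rdet p (replace_row (A * A') (row A' q) p)
      in
        (quasidet_defined A p q \<longleftrightarrow> invertible_elem (left_double_cofactor scale i j A p q)) \<and>
        quasidet A p q
          = scale (ddet scale i j A) (ring_inv (left_double_cofactor scale i j A p q)) \<and>
        quasidet A p q = scale (ddet scale i j A) (ring_inv c) \<and>
        quasidet A p q = scale (ddet scale i j A / qnorm scale i j c) (qconj scale i j c) \<and>
        (quasidet_defined A p q \<longleftrightarrow> invertible_elem (right_double_cofactor scale i j A p q)) \<and>
        quasidet A p q
          = scale (ddet scale i j A) (ring_inv (right_double_cofactor scale i j A p q)) \<and>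
        quasidet A p q = scale (ddet scale i j A) (ring_inv r) \<and>
        quasidet A p q = scale (ddet scale i j A / qnorm scale i j r) (qconj scale i j r))"
proof -
  interpret quaternion_algebra scale a b i j by fact
  define c where "c = cdet q (replace_col (star A * A) (col (star A) p) q)"
  define r where "r = rdet p (replace_row (A * star A) (row (star A) q) p)"
  note A = \<open>A \<in> carrier_mat n n\<close> and p = \<open>p < n\<close> and q = \<open>q < n\<close>
  obtain B where "inverts_mat A B" "inverts_mat B A"
    using \<open>invertible_mat A\<close> by (auto simp: invertible_mat_def)
  note B = mat_inv_eq[OF A this]
  have A': "star A \<in> carrier_mat n n" using A by simp
  obtain \<delta> where \<delta>: "gram_det n A = scale \<delta> 1"
    using gram_det_Z[of n A] by blast
  \<comment> \<open>Otherwise (-1)^n would be 0, although its square is 1.\<close>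
  have "\<delta> \<noteq> 0"
    using gram_det_invertible[OF A B(2-4)] minus_one_power_square[of n] one_nonzero by (auto simp: \<delta>)
  have ddet: "ddet scale i j A = \<delta>"
    unfolding ddet_def hermitian_det_def adjoint_def star_def[symmetric]
  proof (rule the_equality)
    show *: "\<forall>k<dim_row (star A * A). rdet k (star A * A) = scale \<delta> 1 \<and> cdet k (star A * A) = scale \<delta> 1"
      using rdet_gram[OF A'] cdet_gram[OF A'] A by (simp add: gram_det_star[OF A] \<delta>)
    \<comment> \<open>The index \<open>p\<close> keeps the quantifier from being vacuous, so the
      scalar is determined.\<close>
    show "d = \<delta>" if "\<forall>k<dim_row (star A * A). rdet k (star A * A) = scale d 1 \<and> cdet k (star A * A) = scale d 1" for d
      using that * p A by (auto simp: scalar_eq_iff)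
  qed
  have c: "c = scale \<delta> (mat_inv A $$ (q, p))"
    unfolding c_def B(1) using cdet_replace_col_gram[OF A B(2,3) p q] by (simp add: \<delta> scale_mult_left)
  have r: "r = scale \<delta> (mat_inv A $$ (q, p))"
    unfolding r_def B(1) using rdet_replace_row_gram[OF A B(2,4) p q] by (simp add: \<delta> scale_mult_left)
  \<comment> \<open>A non-invertible entry is covered as well: the inverse and the quotient by the
    norm then both take their default value 0.\<close>
  have quasi: "quasidet_defined A p q \<longleftrightarrow> invertible_elem x" "quasidet A p q = scale \<delta> (ring_inv x)"
    "quasidet A p q = scale (\<delta> / qnorm scale i j x) (qc x)" if "x = scale \<delta> (mat_inv A $$ (q, p))" for x
    using ring_inv_scale[OF \<open>\<delta> \<noteq> 0\<close>, of "mat_inv A $$ (q, p)"] ring_inv_eq_qconj[of x] that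
    by (simp_all add: quasidet_defined_def quasidet_def)
  show ?thesis
    unfolding left_double_cofactor_def right_double_cofactor_def Let_def adjoint_def
      star_def[symmetric] c_def[symmetric] r_def[symmetric] ddet
    using quasi[OF c] quasi[OF r] by blast
qed

end
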